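(* Let $f,g:\mathcal X\times\mathcal X\to\mathcal X$ and $a_0,b_0:[0,r]\to\mathcal X$ be smooth enough functions, and let the family of discrete 2D hyperbolic systems $\delta^\epsilon_y a=f^\epsilon(a,b)$, $\delta^\epsilon_x b=g^\epsilon(a,b)$ be an $\mathcal O(\epsilon)$-approximation in the $C^1$ sense of the continuous 2D hyperbolic system $\partial_y a=f(a,b)$, $\partial_x b=g(a,b)$. Let discrete initial data $a_0^\epsilon,b_0^\epsilon:[0,r]^\epsilon\to\mathcal X$ satisfy $$a_0^\epsilon(x)=a_0(x)+\mathcal O(\epsilon),\qquad b_0^\epsilon(y)=b_0(y)+\mathcal O(\epsilon)$$ uniformly for $x\in[0,r]^\epsilon$ and $y\in[0,r]^\epsilon$, respectively. Let $(a^\epsilon,b^\epsilon)$ be the solution on $\Omega^\epsilon(r)$ of the discrete Goursat problem with data $a^\epsilon(x,0)=a^\epsilon_0(x)$, $b^\epsilon(0,y)=b^\epsilon_0(y)$. Then the sequence of solutions converges uniformly in the following sense: there exist $\bar r\in(0,r]$ and a pair of Lipschitz-continuous functions $a,b:\Omega(\bar r)\to\mathcal X$ such that $$a^\epsilon(x,y)=a(x,y)+\mathcal O(\epsilon),\qquad b^\epsilon(x,y)=b(x,y)+\mathcal O(\epsilon)$$ uniformly for all $(x,y)\in\Omega^\epsilon(\bar r)$. The functions $(a,b)$ solve the continuous Goursat problem on $\Omega(\bar r)$: $\partial_y a=f(a,b)$, $\partial_x b=g(a,b)$, $a(x,0)=a_0(x)$, $b(0,y)=b_0(y)$. If $f$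 and $g$ admit global Lipschitz constants, then one can choose $\bar r=r$.
   Context: $\mathcal X$ is a normed vector space with norm $|\cdot|$, and $r>0$. For $\rho>0$ put $\Omega(\rho)=[0,\rho]\times[0,\rho]\subset\mathbb R^2$, $[0,\rho]^\epsilon=[0,\rho]\cap(\epsilon\mathbb Z)$, $\Omega^\epsilon(\rho)=[0,\rho]^\epsilon\times[0,\rho]^\epsilon$. The mesh size $\epsilon$ takes only values $\epsilon=2^{-k}$ with $k$ a positive integer and $\epsilon<\epsilon_0$ for a fixed $\epsilon_0>0$; $\mathcal O(\epsilon)$ means bounded in norm by $C\epsilon$ with $C$ independent of $\epsilon$ (and, when "uniformly" is said, of the indicated variables). Difference quotients: $\delta^\epsilon_x p(x,y)=\frac1\epsilon(p(x+\epsilon,y)-p(x,y))$, $\delta^\epsilon_y p(x,y)=\frac1\epsilon(p(x,y+\epsilon)-p(x,y))$, defined at those grid points where the shifted point is also in the grid domain. A discrete 2D hyperbolic system, for functions $a,b:\Omega^\epsilon(r)\to\mathcal X$, is $\delta^\epsilon_y a=f^\epsilon(a,b)$, $\delta^\epsilon_x b=g^\epsilon(a,b)$ (required wherever the left sides are defined), with smooth $f^\epsilon,g^\epsilon:\mathcal X\times\mathcal X\to\mathcal X$; its Goursat problem prescribes $a(x,0)$ for $x\in[0,r]^\epsilon$ and $b(0,y)$ for $y\in[0,r]^\epsilon$, and has a unique solution. The family is an $\mathcal O(\epsilon)$-approximation in the $C^1$ sense of the continuous system with right-hand sides $f,g$ if $f^\epsilon,g^\epsilon$ depend continuously on $\epsilon\in(0,\epsilon_0)$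 and $f^\epsilon=f+\mathcal O(\epsilon)$, $g^\epsilon=g+\mathcal O(\epsilon)$, together with the analogous relations for the first partial derivatives, uniformly on every compact subset of $\mathcal X\times\mathcal X$.
   Formalization: The normed vector space X is assumed complete (a Banach space); without completeness the claim fails, e.g. for finitely supported sequences with f(a,b) = right shift of a, g = 0, a_0 = e_0, b_0 = 0. *)

theory Defs
  imports "HOL-Analysis.Analysis"
begin

section \<open>Meshes, grids and the order symbol\<close>

definition mesh_sizes :: "real \<Rightarrow> real set" where
  "mesh_sizes \<epsilon>0 = {\<epsilon>. \<epsilon> < \<epsilon>0 \<and> (\<exists>k::nat. 0 < k \<and> \<epsilon> = 1 / 2 ^ k)}"

definition grid :: "real \<Rightarrow> real \<Rightarrow> real set" where
  "grid \<epsilon> \<rho> = {0..\<rho>} \<inter> range (\<lambda>n::int. \<epsilon> * of_int n)"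

definition Grid2 :: "real \<Rightarrow> real \<Rightarrow> (real \<times> real) set" where
  "Grid2 \<epsilon> \<rho> = grid \<epsilon> \<rho> \<times> grid \<epsilon> \<rho>"

definition Square :: "real \<Rightarrow> (real \<times> real) set" where
  "Square \<rho> = {0..\<rho>} \<times> {0..\<rho>}"

text \<open>\<open>eq_up_to_O_eps \<epsilon>0 D u v\<close> reads: \<open>u \<epsilon> p = v p + O(\<epsilon>)\<close> uniformly for \<open>p \<in> D \<epsilon>\<close>. The set of
  points may depend on the mesh size; the constant may depend on neither the mesh size nor \<open>p\<close>.\<close>

definition eq_up_to_O_eps ::
  "real \<Rightarrow> (real \<Rightarrow> 'p set) \<Rightarrow> (real \<Rightarrow> 'p \<Rightarrow> 'v::real_normed_vector) \<Rightarrow> ('p \<Rightarrow> 'v) \<Rightarrow> bool" where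
  "eq_up_to_O_eps \<epsilon>0 D u v \<longleftrightarrow>
     (\<exists>C. \<forall>\<epsilon>\<in>mesh_sizes \<epsilon>0. \<forall>p\<in>D \<epsilon>. norm (u \<epsilon> p - v p) \<le> C * \<epsilon>)"


section \<open>Differentiability\<close>

text \<open>Derivatives are taken within \<open>S\<close>, so they are one-sided at the end points of an interval and
  values of the function outside \<open>S\<close> are irrelevant.\<close>

definition C1_on :: "'v::real_normed_vector set \<Rightarrow> ('v \<Rightarrow> 'w::real_normed_vector) \<Rightarrow> bool" where
  "C1_on S h \<longleftrightarrow>
     (\<exists>h' :: 'v \<Rightarrow> 'v \<Rightarrow>\<^sub>L 'w.
        (\<forall>p\<in>S. (h has_derivative blinfun_apply (h' p)) (at p within S)) \<and> continuous_on S h')"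

text \<open>The partial derivatives are packed as bounded linear maps, so that their distance is measured
  in the operator norm.\<close>

definition partial_fst :: "('v::real_normed_vector \<times> 'w::real_normed_vector \<Rightarrow> 'u::real_normed_vector)
    \<Rightarrow> 'v \<times> 'w \<Rightarrow> 'v \<Rightarrow>\<^sub>L 'u" where
  "partial_fst h p = Blinfun (frechet_derivative (\<lambda>s. h (s, snd p)) (at (fst p)))"

definition partial_snd :: "('v::real_normed_vector \<times> 'w::real_normed_vector \<Rightarrow> 'u::real_normed_vector)
    \<Rightarrow> 'v \<times> 'w \<Rightarrow> 'w \<Rightarrow>\<^sub>L 'u" where
  "partial_snd h p = Blinfun (frechet_derivative (\<lambda>t. h (fst p, t)) (at (snd p)))"

text \<open>Continuous dependence on the mesh parameter is required only pointwise.\<close>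

definition C1_approximation ::
  "real \<Rightarrow> (real \<Rightarrow> 'v::real_normed_vector \<times> 'v \<Rightarrow> 'v) \<Rightarrow> ('v \<times> 'v \<Rightarrow> 'v) \<Rightarrow> bool" where
  "C1_approximation \<epsilon>0 h\<epsilon> h \<longleftrightarrow>
     (\<forall>p. continuous_on {0<..<\<epsilon>0} (\<lambda>\<epsilon>. h\<epsilon> \<epsilon> p)) \<and>
     (\<forall>K. compact K \<longrightarrow>
        eq_up_to_O_eps \<epsilon>0 (\<lambda>_. K) h\<epsilon> h \<and>
        eq_up_to_O_eps \<epsilon>0 (\<lambda>_. K) (\<lambda>\<epsilon>. partial_fst (h\<epsilon> \<epsilon>)) (partial_fst h) \<and>
        eq_up_to_O_eps \<epsilon>0 (\<lambda>_. K) (\<lambda>\<epsilon>. partial_snd (h\<epsilon> \<epsilon>)) (partial_snd h))"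


section \<open>Discrete and continuous Goursat problems\<close>

definition diff_x :: "real \<Rightarrow> (real \<times> real \<Rightarrow> 'v::real_vector) \<Rightarrow> real \<times> real \<Rightarrow> 'v" where
  "diff_x \<epsilon> p = (\<lambda>(x, y). (1 / \<epsilon>) *\<^sub>R (p (x + \<epsilon>, y) - p (x, y)))"

definition diff_y :: "real \<Rightarrow> (real \<times> real \<Rightarrow> 'v::real_vector) \<Rightarrow> real \<times> real \<Rightarrow> 'v" where
  "diff_y \<epsilon> p = (\<lambda>(x, y). (1 / \<epsilon>) *\<^sub>R (p (x, y + \<epsilon>) - p (x, y)))"

text \<open>A function on a grid is represented by a total function whose values off the grid are
  arbitrary and never used.\<close>

definition solves_discrete_Goursat ::
  "real \<Rightarrow> real \<Rightarrow> ('v::real_vector \<times> 'v \<Rightarrow> 'v) \<Rightarrow> ('v \<times> 'v \<Rightarrow> 'v) \<Rightarrow> (real \<Rightarrow> 'v) \<Rightarrow> (real \<Rightarrow> 'v)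
    \<Rightarrow> (real \<times> real \<Rightarrow> 'v) \<Rightarrow> (real \<times> real \<Rightarrow> 'v) \<Rightarrow> bool" where
  "solves_discrete_Goursat \<epsilon> \<rho> f g a0 b0 a b \<longleftrightarrow>
     (\<forall>x y. (x, y) \<in> Grid2 \<epsilon> \<rho> \<and> (x, y + \<epsilon>) \<in> Grid2 \<epsilon> \<rho> \<longrightarrow>
        diff_y \<epsilon> a (x, y) = f (a (x, y), b (x, y))) \<and>
     (\<forall>x y. (x, y) \<in> Grid2 \<epsilon> \<rho> \<and> (x + \<epsilon>, y) \<in> Grid2 \<epsilon> \<rho> \<longrightarrow>
        diff_x \<epsilon> b (x, y) = g (a (x, y), b (x, y))) \<and>
     (\<forall>x\<in>grid \<epsilon> \<rho>. a (x, 0) = a0 x) \<and>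
     (\<forall>y\<in>grid \<epsilon> \<rho>. b (0, y) = b0 y)"

definition solves_Goursat ::
  "real \<Rightarrow> ('v::real_normed_vector \<times> 'v \<Rightarrow> 'v) \<Rightarrow> ('v \<times> 'v \<Rightarrow> 'v) \<Rightarrow> (real \<Rightarrow> 'v) \<Rightarrow> (real \<Rightarrow> 'v)
    \<Rightarrow> (real \<times> real \<Rightarrow> 'v) \<Rightarrow> (real \<times> real \<Rightarrow> 'v) \<Rightarrow> bool" where
  "solves_Goursat \<rho> f g a0 b0 a b \<longleftrightarrow>
     (\<forall>(x, y)\<in>Square \<rho>.
        ((\<lambda>t. a (x, t)) has_vector_derivative f (a (x, y), b (x, y))) (at y within {0..\<rho>}) \<and>
        ((\<lambda>s. b (s, y)) has_vector_derivative g (a (x, y), b (x, y))) (at x within {0..\<rho>})) \<and>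
     (\<forall>x\<in>{0..\<rho>}. a (x, 0) = a0 x) \<and>
     (\<forall>y\<in>{0..\<rho>}. b (0, y) = b0 y)"

definition is_Lipschitz_on :: "'p::metric_space set \<Rightarrow> ('p \<Rightarrow> 'q::metric_space) \<Rightarrow> bool" where
  "is_Lipschitz_on S h \<longleftrightarrow> (\<exists>L. lipschitz_on L S h)"

text \<open>The mode of convergence on \<open>Square \<rho>\<close>: Lipschitz limit functions that solve the
  continuous Goursat problem and are approximated up to \<open>O(\<epsilon>)\<close> on the grids.\<close>

definition converges_to_Goursat_solution ::
  "real \<Rightarrow> real \<Rightarrow> ('v::real_normed_vector \<times> 'v \<Rightarrow> 'v) \<Rightarrow> ('v \<times> 'v \<Rightarrow> 'v) \<Rightarrow> (real \<Rightarrow> 'v) \<Rightarrow> (real \<Rightarrow> 'v)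
    \<Rightarrow> (real \<Rightarrow> real \<times> real \<Rightarrow> 'v) \<Rightarrow> (real \<Rightarrow> real \<times> real \<Rightarrow> 'v) \<Rightarrow> bool" where
  "converges_to_Goursat_solution \<epsilon>0 \<rho> f g a0 b0 a\<epsilon> b\<epsilon> \<longleftrightarrow>
     (\<exists>a b. is_Lipschitz_on (Square \<rho>) a \<and> is_Lipschitz_on (Square \<rho>) b \<and>
        eq_up_to_O_eps \<epsilon>0 (\<lambda>\<epsilon>. Grid2 \<epsilon> \<rho>) a\<epsilon> a \<and>
        eq_up_to_O_eps \<epsilon>0 (\<lambda>\<epsilon>. Grid2 \<epsilon> \<rho>) b\<epsilon> b \<and>
        solves_Goursat \<rho> f g a0 b0 a b)"

end

theory Submission
  imports Defs
begin

text \<open>The continuous problem is solved first: for globally Lipschitz right-hand sides, Picard iteration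
  contracts in the norm weighted by \<open>exp (- 4 * L * (x + y))\<close>, so it converges on the whole square. If
  the right-hand sides are only \<open>C\<^sup>1\<close>, they are composed with the radial retraction onto a small ball
  around the corner value; on a small square the solution stays in that ball. The values of
  the solution form a compact set, near which \<open>f\<close> and \<open>g\<close> are Lipschitz and the discrete
  right-hand sides are uniformly \<open>O(\<epsilon>)\<close>-close. The error of the discrete solution, whose one-step
  consistency error is \<open>O(\<epsilon>\<^sup>2)\<close>, then satisfies a discrete Gronwall inequality. It keeps the discrete
  solution in that neighbourhood when \<open>\<epsilon>\<close> is small; the finitely many remaining mesh sizes only
  affect the constant.\<close>

section \<open>Picard iteration\<close>

text \<open>Bounded sets in an infinite-dimensional space need not be relatively compact, so the
  limit cannot be extracted from the discrete solutions by an argument of Arzela-Ascoli type. A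
  solution of the continuous problem obtained independently supplies the limit, and comparison with
  a known function yields the rate directly. What the comparison asks of that solution is Lipschitz
  continuity in both variables: over one step the right-hand side is then evaluated at values that
  differ by O(\<epsilon>), so the step error is quadratic without second derivatives. Along its own
  direction (\<open>y\<close> for \<open>a\<close>, \<open>x\<close> for \<open>b\<close>) each
  unknown is Lipschitz as an integral of a bounded function. But a step in \<open>y\<close> changes
  both arguments of \<open>f\<close>, so the transverse directions matter as well; there regularity
  comes from the Lipschitz initial data, transported by a Gronwall argument.\<close>

lemma norm_integral_exp_bound:
  fixes h :: "real \<Rightarrow> 'v::banach"
  assumes "continuous_on {0..y} h" "0 \<le> y" "0 < c" "0 \<le> A"
    and "\<And>t. t \<in> {0..y} \<Longrightarrow> norm (h t) \<le> A * exp (c * (x + t))"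
  shows "norm (integral {0..y} h) \<le> A / c * exp (c * (x + y))"
proof -
  have *: "((\<lambda>t. A * exp (c * (x + t))) has_integral
      (A / c * exp (c * (x + y)) - A / c * exp (c * (x + 0)))) {0..y}"
    using \<open>0 \<le> y\<close> \<open>0 < c\<close>
    by (intro fundamental_theorem_of_calculus)
       (auto intro!: derivative_eq_intros simp: has_real_derivative_iff_has_vector_derivative[symmetric])
  have "norm (integral {0..y} h) \<le> integral {0..y} (\<lambda>t. A * exp (c * (x + t)))"
    using * assms(1,5)
    by (intro Henstock_Kurzweil_Integration.integral_norm_bound_integral integrable_continuous_real)
       (auto simp: has_integral_integrable intro!: continuous_intros)
  also have "\<dots> = A / c * exp (c * (x + y)) - A / c * exp (c * (x + 0))"
    using * by (rule integral_unique)
  also have "\<dots> \<le> A / c * exp (c * (x + y))"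
    using assms by simp
  finally show ?thesis .
qed

text \<open>At a point \<open>z\<close> where the norm of \<open>w\<close> weighted by
  \<open>exp (- (2 * K * t))\<close> is largest, integrating against the weight gains
  \<open>1 / (2 * K)\<close>. The integral thus contributes at most \<open>(m + c) / 2\<close>, and
  \<open>m\<close> is absorbed on the left. The integrand \<open>h\<close> is kept apart from
  \<open>w\<close> because in the application it depends on a second unknown, whose contribution is
  \<open>c\<close>.\<close>

lemma integral_Gronwall:
  fixes w h :: "real \<Rightarrow> 'v::banach"
  assumes "continuous_on {0..r} w" "continuous_on {0..r} h" "0 < K" "0 \<le> c"
    and w: "\<And>y. y \<in> {0..r} \<Longrightarrow> w y = w0 + integral {0..y} h"
    and h: "\<And>t. t \<in> {0..r} \<Longrightarrow> norm (h t) \<le> K * (norm (w t) + c)"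
    and y: "y \<in> {0..r}"
  shows "norm (w y) \<le> (2 * norm w0 + c) * exp (2 * K * y)"
proof -
  have "\<exists>z\<in>{0..r}. \<forall>t\<in>{0..r}. norm (w t) * exp (- (2 * K * t)) \<le> norm (w z) * exp (- (2 * K * z))"
    using y assms(1) by (intro continuous_attains_sup) (auto intro!: continuous_intros)
  then obtain z where z: "z \<in> {0..r}"
    and sup: "\<And>t. t \<in> {0..r} \<Longrightarrow> norm (w t) * exp (- (2 * K * t)) \<le> norm (w z) * exp (- (2 * K * z))"
    by blast
  define m where "m = norm (w z) * exp (- (2 * K * z))"
  have m0: "0 \<le> m" by (simp add: m_def)
  have wm: "norm (w t) \<le> m * exp (2 * K * t)" if "t \<in> {0..r}" for t
    using sup[OF that] by (simp add: m_def exp_minus field_simps)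
  have K2: "K * (m + c) / (2 * K) = (m + c) / 2"
    using \<open>0 < K\<close> by simp
  have "norm (integral {0..z} h) \<le> K * (m + c) / (2 * K) * exp (2 * K * (0 + z))"
  proof (rule norm_integral_exp_bound)
    show "continuous_on {0..z} h"
      using assms(2) z by (auto intro: continuous_on_subset)
    fix t assume t: "t \<in> {0..z}"
    then have "norm (h t) \<le> K * (norm (w t) + c)" using h z by auto
    also have "\<dots> \<le> K * (m * exp (2 * K * t) + c * exp (2 * K * t))"
      using t z \<open>0 < K\<close> \<open>0 \<le> c\<close> wm[of t]
      by (intro mult_left_mono add_mono) (auto simp: mult_le_cancel_left1)
    finally show "norm (h t) \<le> K * (m + c) * exp (2 * K * (0 + t))"
      by (simp add: algebra_simps)
  qed (use z \<open>0 < K\<close> \<open>0 \<le> c\<close> m0 in auto)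
  moreover have "norm (w z) \<le> norm w0 + norm (integral {0..z} h)"
    using w[OF z] norm_triangle_ineq by metis
  moreover have "norm (w z) = m * exp (2 * K * z)"
    by (simp add: m_def exp_minus)
  moreover have "norm w0 \<le> norm w0 * exp (2 * K * z)"
    using z \<open>0 < K\<close> by (auto simp: mult_le_cancel_left1)
  ultimately have "m * exp (2 * K * z) \<le> (norm w0 + (m + c) / 2) * exp (2 * K * z)"
    unfolding K2 by (simp add: algebra_simps add_divide_distrib)
  then have "m \<le> norm w0 + (m + c) / 2" by simp
  then have "m \<le> 2 * norm w0 + c" by (simp add: field_simps)
  then have "m * exp (2 * K * y) \<le> (2 * norm w0 + c) * exp (2 * K * y)" by simp
  then show ?thesis using wm[OF y] by linarith
qed

text \<open>The point moves the upper limit of integration. Rescaling to the fixed interval from 0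
  to 1 moves this dependence into the integrand, where continuity of parameter integrals
  applies.\<close>

lemma continuous_on_integral_snd:
  fixes h :: "real \<times> real \<Rightarrow> 'v::banach"
  assumes "continuous_on (Square r) h"
  shows "continuous_on (Square r) (\<lambda>(x, y). integral {0..y} (\<lambda>t. h (x, t)))"
proof -
  have eq: "integral {0..y} (\<lambda>t. h (x, t)) = y *\<^sub>R integral {0..1} (\<lambda>t. h (x, y * t))"
    if "(x, y) \<in> Square r" for x y
  proof (cases "y = 0")
    case False
    then have y: "0 < y" using that by (auto simp: Square_def)
    have "continuous_on {0..y} (\<lambda>t. h (x, t))"
      using that by (intro continuous_on_compose2[OF assms]) (auto intro!: continuous_intros simp: Square_def)
    then have "((\<lambda>t. h (x, t)) has_integral integral {0..y} (\<lambda>t. h (x, t))) {0..y}"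
      by (intro integrable_integral integrable_continuous_real)
    from has_integral_stretch_real[OF this, of y] y
    have "((\<lambda>t. h (x, y * t)) has_integral (1 / y) *\<^sub>R integral {0..y} (\<lambda>t. h (x, t))) {0..1}"
      by (simp add: image_divide_atLeastAtMost)
    from integral_unique[OF this] y show ?thesis by simp
  qed simp
  have "continuous_on (Square r) (\<lambda>p. integral (cbox 0 1) (\<lambda>t. h (fst p, snd p * t)))"
    by (rule integral_continuous_on_param, unfold case_prod_unfold, rule continuous_on_compose2[OF assms])
       (auto intro!: continuous_intros simp: Square_def intro: order_trans[OF mult_right_le_one_le])
  then have "continuous_on (Square r) (\<lambda>p. snd p *\<^sub>R integral {0..1} (\<lambda>t. h (fst p, snd p * t)))"
    by (auto intro!: continuous_intros)
  then show ?thesis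
    by (rule continuous_on_eq) (auto simp: eq)
qed

lemma continuous_on_integral_fst:
  fixes h :: "real \<times> real \<Rightarrow> 'v::banach"
  assumes "continuous_on (Square r) h"
  shows "continuous_on (Square r) (\<lambda>(x, y). integral {0..x} (\<lambda>s. h (s, y)))"
proof -
  have "continuous_on (Square r) (\<lambda>p. h (prod.swap p))"
    by (rule continuous_on_compose2[OF assms]) (auto intro!: continuous_intros simp: Square_def)
  from continuous_on_integral_snd[OF this]
  have "continuous_on (Square r) (\<lambda>(y, x). integral {0..x} (\<lambda>s. h (s, y)))" by simp
  then have "continuous_on (Square r) (\<lambda>p. (\<lambda>(y, x). integral {0..x} (\<lambda>s. h (s, y))) (prod.swap p))"
    by (rule continuous_on_compose2) (auto intro!: continuous_intros simp: Square_def)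
  then show ?thesis by (simp add: case_prod_unfold)
qed

text \<open>The Goursat problem in integrated form, with the initial data built in; the two unknowns
  are iterated together as one pair.\<close>

definition Picard ::
  "('v::banach \<times> 'v \<Rightarrow> 'v) \<Rightarrow> ('v \<times> 'v \<Rightarrow> 'v) \<Rightarrow> (real \<Rightarrow> 'v) \<Rightarrow> (real \<Rightarrow> 'v)
    \<Rightarrow> (real \<times> real \<Rightarrow> 'v \<times> 'v) \<Rightarrow> real \<times> real \<Rightarrow> 'v \<times> 'v" where
  "Picard f g a0 b0 u = (\<lambda>(x, y).
     (a0 x + integral {0..y} (\<lambda>t. f (u (x, t))), b0 y + integral {0..x} (\<lambda>s. g (u (s, y)))))"

lemma continuous_on_Picard:
  assumes "continuous_on UNIV f" "continuous_on UNIV g"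
    and "continuous_on {0..r} a0" "continuous_on {0..r} b0" and u: "continuous_on (Square r) u"
  shows "continuous_on (Square r) (Picard f g a0 b0 u)"
proof -
  have "continuous_on (Square r) (\<lambda>p. f (u p))" "continuous_on (Square r) (\<lambda>p. g (u p))"
    by (auto intro: continuous_on_compose2[OF assms(1)] continuous_on_compose2[OF assms(2)] u)
  from continuous_on_integral_snd[OF this(1)] continuous_on_integral_fst[OF this(2)]
  show ?thesis
    unfolding Picard_def case_prod_unfold
    by (intro continuous_intros) (auto intro!: continuous_intros
        intro: continuous_on_compose2[OF assms(3)] continuous_on_compose2[OF assms(4)] simp: Square_def)
qed

text \<open>Integrating the weight in either variable gains \<open>1 / (4 * L)\<close>, which
  against the Lipschitz constant \<open>L\<close> leaves 1/4 for each component; the norm of a pair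
  is at most the sum of the two, whence 1/2. The pointwise form with a free \<open>A\<close>
  replaces a function space with a weighted norm, and it applies both to consecutive iterates and to
  an iterate and the limit.\<close>

lemma Picard_contraction:
  fixes f g :: "'v::banach \<times> 'v \<Rightarrow> 'v"
  assumes f: "L-lipschitz_on UNIV f" and g: "L-lipschitz_on UNIV g" and "0 < L" "0 \<le> A"
    and u: "continuous_on (Square r) u" and v: "continuous_on (Square r) v"
    and uv: "\<And>x y. (x, y) \<in> Square r \<Longrightarrow> norm (u (x, y) - v (x, y)) \<le> A * exp (4 * L * (x + y))"
    and xy: "(x, y) \<in> Square r"
  shows "norm (Picard f g a0 b0 u (x, y) - Picard f g a0 b0 v (x, y)) \<le> A / 2 * exp (4 * L * (x + y))"
proof -
  have fg: "continuous_on UNIV f" "continuous_on UNIV g"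
    using f g by (auto intro: lipschitz_on_continuous_on)
  have [simp]: "0 \<le> x" "x \<le> r" "0 \<le> y" "y \<le> r" using xy by (auto simp: Square_def)
  have comp: "continuous_on {0..z} (\<lambda>t. h (w (p t)))"
    if "continuous_on UNIV h" "continuous_on (Square r) w" "continuous_on {0..z} p" "p ` {0..z} \<subseteq> Square r"
    for z and h :: "'v \<times> 'v \<Rightarrow> 'v" and w p
    by (rule continuous_on_compose2[OF that(1)], rule continuous_on_compose2[OF that(2)]) (use that in auto)
  have sub: "t \<le> y \<Longrightarrow> t \<le> r" "s \<le> x \<Longrightarrow> s \<le> r" for t s by (auto intro: order_trans)
  have 1: "continuous_on {0..y} (\<lambda>t. f (w (x, t)))" if "continuous_on (Square r) w" for w
    by (rule comp[OF fg(1) that]) (auto intro!: continuous_intros simp: Square_def sub)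
  have 2: "continuous_on {0..x} (\<lambda>s. g (w (s, y)))" if "continuous_on (Square r) w" for w
    by (rule comp[OF fg(2) that]) (auto intro!: continuous_intros simp: Square_def sub)
  have "norm (integral {0..y} (\<lambda>t. f (u (x, t)) - f (v (x, t)))) \<le> (L * A) / (4 * L) * exp (4 * L * (x + y))"
  proof (rule norm_integral_exp_bound)
    fix t assume t: "t \<in> {0..y}"
    have "norm (f (u (x, t)) - f (v (x, t))) \<le> L * norm (u (x, t) - v (x, t))"
      using lipschitz_onD[OF f] by (simp add: dist_norm)
    also have "\<dots> \<le> L * (A * exp (4 * L * (x + t)))"
      using t \<open>0 < L\<close> by (intro mult_left_mono uv) (auto simp: Square_def intro: order_trans)
    finally show "norm (f (u (x, t)) - f (v (x, t))) \<le> L * A * exp (4 * L * (x + t))" by simp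
  qed (use \<open>0 < L\<close> \<open>0 \<le> A\<close> 1[OF u] 1[OF v] in \<open>auto intro!: continuous_intros\<close>)
  moreover have "norm (integral {0..x} (\<lambda>s. g (u (s, y)) - g (v (s, y)))) \<le> (L * A) / (4 * L) * exp (4 * L * (y + x))"
  proof (rule norm_integral_exp_bound)
    fix t assume t: "t \<in> {0..x}"
    have "norm (g (u (t, y)) - g (v (t, y))) \<le> L * norm (u (t, y) - v (t, y))"
      using lipschitz_onD[OF g] by (simp add: dist_norm)
    also have "\<dots> \<le> L * (A * exp (4 * L * (t + y)))"
      using t \<open>0 < L\<close> by (intro mult_left_mono uv) (auto simp: Square_def intro: order_trans)
    finally show "norm (g (u (t, y)) - g (v (t, y))) \<le> L * A * exp (4 * L * (y + t))"
      by (simp add: add.commute)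
  qed (use \<open>0 < L\<close> \<open>0 \<le> A\<close> 2[OF u] 2[OF v] in \<open>auto intro!: continuous_intros\<close>)
  moreover have "Picard f g a0 b0 u (x, y) - Picard f g a0 b0 v (x, y) =
      (integral {0..y} (\<lambda>t. f (u (x, t)) - f (v (x, t))), integral {0..x} (\<lambda>s. g (u (s, y)) - g (v (s, y))))"
    by (simp add: Picard_def Henstock_Kurzweil_Integration.integral_diff integrable_continuous_real 1[OF u] 1[OF v] 2[OF u] 2[OF v])
  ultimately show ?thesis
    using norm_Pair_le[of "integral {0..y} (\<lambda>t. f (u (x, t)) - f (v (x, t)))"
        "integral {0..x} (\<lambda>s. g (u (s, y)) - g (v (s, y)))"] \<open>0 < L\<close>
    by (simp add: add.commute)
qed

lemma Picard_fixpoint: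
  fixes f g :: "'v::banach \<times> 'v \<Rightarrow> 'v"
  assumes f: "L-lipschitz_on UNIV f" and g: "L-lipschitz_on UNIV g" and L: "0 < L"
    and a0: "continuous_on {0..r} a0" and b0: "continuous_on {0..r} b0"
  obtains u where "continuous_on (Square r) u" "\<And>p. p \<in> Square r \<Longrightarrow> u p = Picard f g a0 b0 u p"
proof -
  let ?T = "Picard f g a0 b0"
  define U where "U n = (?T ^^ n) (\<lambda>_. 0)" for n
  have fg: "continuous_on UNIV f" "continuous_on UNIV g"
    using f g by (auto intro: lipschitz_on_continuous_on)
  have U_Suc: "U (Suc n) = ?T (U n)" and U_0: "U 0 = (\<lambda>_. 0)" for n by (auto simp: U_def)
  have contU: "continuous_on (Square r) (U n)" for n
    by (induction n) (auto simp: U_Suc U_0 intro!: continuous_on_Picard fg a0 b0)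
  have cpt: "compact (Square r)" by (auto simp: Square_def intro: compact_Times)
  have "bounded (U 1 ` Square r)"
    by (intro compact_imp_bounded compact_continuous_image contU cpt)
  then obtain C where C: "0 < C" "\<And>p. p \<in> Square r \<Longrightarrow> norm (U 1 p) \<le> C"
    unfolding bounded_pos by auto
  have step: "norm (U (Suc n) (x, y) - U n (x, y)) \<le> C * (1/2)^n * exp (4 * L * (x + y))"
    if "(x, y) \<in> Square r" for n x y
    using that
  proof (induction n arbitrary: x y)
    case 0
    have "norm (U 1 (x, y)) \<le> C * 1" using C 0 by simp
    also have "\<dots> \<le> C * exp (4 * L * (x + y))"
      using C L 0 by (intro mult_left_mono) (auto simp: Square_def)
    finally show ?case by (simp add: U_0)
  next
    case (Suc n)
    from Picard_contraction[OF f g L _ contU[of "Suc n"] contU[of n] Suc.IH Suc.prems, of a0 b0] C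
    show ?case by (simp add: U_Suc)
  qed
  \<comment> \<open>The weight is replaced by its value at the far corner, which makes the majorant
    independent of the point.\<close>
  let ?M = "\<lambda>n::nat. (C * exp (4 * L * (r + r))) * (1/2)^n"
  have bnd: "norm (U (Suc n) p - U n p) \<le> ?M n" if "p \<in> Square r" for n p
  proof -
    obtain x y where p: "p = (x, y)" by (cases p)
    have "norm (U (Suc n) p - U n p) \<le> C * (1/2)^n * exp (4 * L * (x + y))"
      using step that by (simp add: p)
    also have "\<dots> \<le> C * (1/2)^n * exp (4 * L * (r + r))"
      using C L that by (intro mult_left_mono) (auto simp: Square_def p intro!: add_mono)
    finally show ?thesis by (simp add: mult_ac)
  qed
  have "uniform_limit (Square r) (\<lambda>n p. \<Sum>i<n. U (Suc i) p - U i p)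
          (\<lambda>p. suminf (\<lambda>i. U (Suc i) p - U i p)) sequentially"
    by (rule Weierstrass_m_test[OF bnd]) (auto intro!: summable_mult summable_geometric)
  \<comment> \<open>The iteration starts at 0, so the partial sums telescope to the iterates
    themselves.\<close>
  then have "uniform_limit (Square r) U (\<lambda>p. suminf (\<lambda>i. U (Suc i) p - U i p)) sequentially"
    using sum_lessThan_telescope[of "\<lambda>i. U i p" for p] by (simp add: U_0)
  then obtain u where u: "uniform_limit (Square r) U u sequentially" ..
  have contu: "continuous_on (Square r) u"
    by (rule uniform_limit_theorem[OF _ u]) (auto simp: contU)
  have "u p = ?T u p" if p: "p \<in> Square r" for p
  proof -
    have "(\<lambda>n. U (Suc n) p) \<longlonglongrightarrow> u p"
      using tendsto_uniform_limitI[OF u p] by (rule LIMSEQ_Suc)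
    moreover have "(\<lambda>n. ?T (U n) p) \<longlonglongrightarrow> ?T u p"
    proof (rule tendstoI)
      fix e :: real assume "0 < e"
      obtain x y where [simp]: "p = (x, y)" by (cases p)
      \<comment> \<open>The weight is at least 1, so a uniform distance below \<open>d\<close> is
        also a weighted bound with constant \<open>d\<close>. The exponential factor in
        \<open>d\<close> cancels the weight at \<open>p\<close>, which leaves \<open>e / 2\<close>
        after one contraction.\<close>
      define d where "d = e * exp (- (4 * L * (x + y)))"
      have "0 < d" using \<open>0 < e\<close> by (simp add: d_def)
      from uniform_limitD[OF u this] show "\<forall>\<^sub>F n in sequentially. dist (?T (U n) p) (?T u p) < e"
      proof eventually_elim
        case (elim n)
        have "norm (?T (U n) (x, y) - ?T u (x, y)) \<le> d / 2 * exp (4 * L * (x + y))"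
        proof (rule Picard_contraction[OF f g L _ contU contu])
          fix x y assume xy: "(x, y) \<in> Square r"
          have "norm (U n (x, y) - u (x, y)) \<le> d * 1"
            using elim xy by (auto simp: dist_norm intro: less_imp_le)
          also have "\<dots> \<le> d * exp (4 * L * (x + y))"
            using xy L \<open>0 < d\<close> by (intro mult_left_mono) (auto simp: Square_def)
          finally show "norm (U n (x, y) - u (x, y)) \<le> d * exp (4 * L * (x + y))" .
        qed (use p \<open>0 < d\<close> in auto)
        also have "\<dots> = e / 2" by (simp add: d_def exp_minus)
        finally show ?case using \<open>0 < e\<close> by (simp add: dist_norm)
      qed
    qed
    ultimately show ?thesis unfolding U_Suc by (rule LIMSEQ_unique)
  qed
  with contu show ?thesis by (rule that)
qed

section \<open>Lipschitz solutions of the continuous problem\<close>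

lemma C1_on_imp_lipschitz_on_interval:
  fixes h :: "real \<Rightarrow> 'v::real_normed_vector"
  assumes "C1_on {a..b} h"
  obtains L where "L-lipschitz_on {a..b} h"
proof -
  obtain h' where h': "\<And>p. p \<in> {a..b} \<Longrightarrow> (h has_derivative blinfun_apply (h' p)) (at p within {a..b})"
    and cont: "continuous_on {a..b} h'"
    using assms unfolding C1_on_def by blast
  have "bounded (h' ` {a..b})"
    by (intro compact_imp_bounded compact_continuous_image cont) auto
  then obtain L where L: "0 < L" "\<And>p. p \<in> {a..b} \<Longrightarrow> norm (h' p) \<le> L"
    unfolding bounded_pos by auto
  have "L-lipschitz_on {a..b} h"
  proof (rule lipschitz_onI)
    fix x y assume "x \<in> {a..b}" "y \<in> {a..b}"
    then show "dist (h x) (h y) \<le> L * dist x y"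
      unfolding dist_norm using L(2)
      by (intro differentiable_bound[OF _ h']) (auto simp: norm_blinfun.rep_eq)
  qed (use L in auto)
  then show ?thesis by (rule that)
qed

text \<open>Balls need not be compact here, so the derivative cannot be bounded by a maximum.
  Continuity at \<open>p\<close> bounds it nearby by \<open>norm (h' p) + 1\<close>, and convexity
  of the ball gives the mean value inequality.\<close>

lemma C1_on_imp_local_lipschitz_on:
  fixes h :: "'v::real_normed_vector \<Rightarrow> 'w::real_normed_vector"
  assumes "C1_on UNIV h"
  obtains d L where "0 < d" "L-lipschitz_on (ball p d) h"
proof -
  obtain h' where h': "\<And>p. (h has_derivative blinfun_apply (h' p)) (at p)"
    and cont: "continuous_on UNIV h'"
    using assms by (auto simp: C1_on_def)
  have "isCont h' p" using cont by (simp add: continuous_on_eq_continuous_at)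
  then obtain d where d: "0 < d" "\<And>q. dist q p < d \<Longrightarrow> dist (h' q) (h' p) < 1"
    unfolding continuous_at_eps_delta by (metis zero_less_one)
  have bnd: "norm (h' q) \<le> norm (h' p) + 1" if "q \<in> ball p d" for q
    using d(2)[of q] that norm_triangle_ineq2[of "h' q" "h' p"] by (simp add: dist_norm norm_minus_commute)
  have "(norm (h' p) + 1)-lipschitz_on (ball p d) h"
  proof (rule lipschitz_onI)
    fix x y assume "x \<in> ball p d" "y \<in> ball p d"
    then show "dist (h x) (h y) \<le> (norm (h' p) + 1) * dist x y"
      unfolding dist_norm using bnd
      by (intro differentiable_bound[OF convex_ball has_derivative_at_withinI[OF h']])
         (auto simp: norm_blinfun.rep_eq)
  qed auto
  with d(1) show ?thesis by (rule that)
qed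

text \<open>This treats the direction in which \<open>a\<close> is not integrated. The difference of
  the columns over \<open>x\<close> and \<open>x'\<close> satisfies an integral inequality in
  \<open>y\<close>, in which the dependence of \<open>b\<close> on \<open>x\<close> enters as the
  additive term \<open>M * dist x x'\<close>. Gronwall makes the whole difference proportional to
  \<open>dist x x'\<close>.\<close>

lemma lipschitz_fst_of_integral_equation:
  fixes f :: "'v::banach \<times> 'v \<Rightarrow> 'v"
  assumes f: "L-lipschitz_on UNIV f" and L: "0 < L"
    and a0: "L0-lipschitz_on {0..r} a0"
    and a: "continuous_on (Square r) a" and b: "continuous_on (Square r) b"
    and eq: "\<And>x y. (x, y) \<in> Square r \<Longrightarrow> a (x, y) = a0 x + integral {0..y} (\<lambda>t. f (a (x, t), b (x, t)))"
    and M: "\<And>y. y \<in> {0..r} \<Longrightarrow> M-lipschitz_on {0..r} (\<lambda>x. b (x, y))"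
  obtains K where "\<And>y. y \<in> {0..r} \<Longrightarrow> K-lipschitz_on {0..r} (\<lambda>x. a (x, y))"
proof (cases "0 \<le> r")
  case True
  have L0: "0 \<le> L0" and M0: "0 \<le> M"
    using a0 M[of 0] True by (auto simp: lipschitz_on_def)
  have cont: "continuous_on {0..r} (\<lambda>t. w (x, t))" if "x \<in> {0..r}" "continuous_on (Square r) w"
    for x and w :: "real \<times> real \<Rightarrow> 'v"
    by (rule continuous_on_compose2[OF that(2)]) (use that(1) in \<open>auto intro!: continuous_intros simp: Square_def\<close>)
  have contf: "continuous_on {0..r} (\<lambda>t. f (a (x, t), b (x, t)))" if "x \<in> {0..r}" for x
    by (rule continuous_on_compose2[OF lipschitz_on_continuous_on[OF f]])
       (use that in \<open>auto intro!: continuous_intros cont a b\<close>)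
  \<comment> \<open>The exponential is taken at \<open>r\<close> so that one constant serves every
    \<open>y\<close>.\<close>
  let ?K = "(2 * L0 + M) * exp (2 * L * r)"
  have "?K-lipschitz_on {0..r} (\<lambda>x. a (x, y))" if y: "y \<in> {0..r}" for y
  proof (rule lipschitz_onI)
    fix x x' assume x: "x \<in> {0..r}" and x': "x' \<in> {0..r}"
    let ?w = "\<lambda>t. a (x, t) - a (x', t)"
    let ?h = "\<lambda>t. f (a (x, t), b (x, t)) - f (a (x', t), b (x', t))"
    have "norm (?w y) \<le> (2 * norm (a0 x - a0 x') + M * dist x x') * exp (2 * L * y)"
    proof (rule integral_Gronwall[where h = ?h and w = ?w and r = r])
      show "continuous_on {0..r} ?w" "continuous_on {0..r} ?h"
        using x x' by (auto intro!: continuous_intros cont contf a b)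
      show "?w t = a0 x - a0 x' + integral {0..t} ?h" if t: "t \<in> {0..r}" for t
      proof -
        have "(\<lambda>t. f (a (z, t), b (z, t))) integrable_on {0..t}" if "z \<in> {0..r}" for z
          using continuous_on_subset[OF contf[OF that], of "{0..t}"] t
          by (auto intro: integrable_continuous_real)
        then show ?thesis
          using x x' t eq by (simp add: Henstock_Kurzweil_Integration.integral_diff Square_def)
      qed
      show "norm (?h t) \<le> L * (norm (?w t) + M * dist x x')" if t: "t \<in> {0..r}" for t
      proof -
        have "norm (?h t) \<le> L * norm ((a (x, t), b (x, t)) - (a (x', t), b (x', t)))"
          using lipschitz_onD[OF f UNIV_I UNIV_I] unfolding dist_norm .
        also have "\<dots> \<le> L * (norm (a (x, t) - a (x', t)) + norm (b (x, t) - b (x', t)))"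
          using L norm_Pair_le by (intro mult_left_mono) auto
        also have "\<dots> \<le> L * (norm (?w t) + M * dist x x')"
          using L lipschitz_onD[OF M[OF t] x x'] by (intro mult_left_mono add_left_mono) (auto simp: dist_norm)
        finally show ?thesis .
      qed
    qed (use L M0 y in auto)
    also have "\<dots> \<le> (2 * (L0 * dist x x') + M * dist x x') * exp (2 * L * r)"
      using lipschitz_onD[OF a0 x x'] M0 L0 L y
      by (intro mult_mono add_mono) (auto simp: dist_norm)
    finally show "dist (a (x, y)) (a (x', y)) \<le> ?K * dist x x'"
      by (simp add: dist_norm algebra_simps)
  qed (use L0 M0 in auto)
  then show ?thesis by (rule that)
qed (use that in auto)

lemma lipschitz_on_Square:
  fixes a :: "real \<times> real \<Rightarrow> 'v::metric_space"
  assumes K: "\<And>y. y \<in> {0..r} \<Longrightarrow> K-lipschitz_on {0..r} (\<lambda>x. a (x, y))"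
    and M: "\<And>x. x \<in> {0..r} \<Longrightarrow> M-lipschitz_on {0..r} (\<lambda>y. a (x, y))"
  shows "is_Lipschitz_on (Square r) a"
proof (cases "0 \<le> r")
  case True
  have "0 \<le> K" "0 \<le> M" using K[of 0] M[of 0] True by (auto simp: lipschitz_on_def)
  have "(K + M)-lipschitz_on (Square r) a"
  proof (rule lipschitz_onI)
    fix p q assume "p \<in> Square r" "q \<in> Square r"
    moreover obtain x y x' y' where [simp]: "p = (x, y)" "q = (x', y')" by (cases p, cases q)
    ultimately have x: "x \<in> {0..r}" "x' \<in> {0..r}" and y: "y \<in> {0..r}" "y' \<in> {0..r}"
      by (auto simp: Square_def)
    have "dist (a p) (a q) \<le> dist (a (x, y)) (a (x', y)) + dist (a (x', y)) (a (x', y'))"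
      by (simp add: dist_triangle)
    also have "\<dots> \<le> K * dist x x' + M * dist y y'"
      using lipschitz_onD[OF K[OF y(1)] x] lipschitz_onD[OF M[OF x(2)] y] by linarith
    also have "\<dots> \<le> K * dist p q + M * dist p q"
      using \<open>0 \<le> K\<close> \<open>0 \<le> M\<close> dist_fst_le[of p q] dist_snd_le[of p q]
      by (intro add_mono mult_left_mono) auto
    finally show "dist (a p) (a q) \<le> (K + M) * dist p q" by (simp add: algebra_simps)
  qed (use \<open>0 \<le> K\<close> \<open>0 \<le> M\<close> in auto)
  then show ?thesis by (auto simp: is_Lipschitz_on_def)
next
  case False
  then show ?thesis by (auto simp: is_Lipschitz_on_def Square_def intro!: exI[of _ 0] lipschitz_onI)
qed

lemma has_vector_derivative_imp_lipschitz_on: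
  fixes w :: "real \<Rightarrow> 'v::real_normed_vector"
  assumes "\<And>t. t \<in> {a..b} \<Longrightarrow> (w has_vector_derivative w' t) (at t within {a..b})"
    and "\<And>t. t \<in> {a..b} \<Longrightarrow> norm (w' t) \<le> M" and "0 \<le> M"
  shows "M-lipschitz_on {a..b} w"
proof (rule lipschitz_onI)
  fix x y assume "x \<in> {a..b}" "y \<in> {a..b}"
  then show "dist (w x) (w y) \<le> M * dist x y"
    unfolding dist_norm using assms(1,2)
    by (intro differentiable_bound[of "{a..b}" w "\<lambda>t s. s *\<^sub>R w' t"])
       (auto simp: has_vector_derivative_def onorm_scaleR_left onorm_id)
qed (fact assms(3))

lemma global_Goursat_solution:
  fixes f g :: "'v::banach \<times> 'v \<Rightarrow> 'v"
  assumes f: "L-lipschitz_on UNIV f" and g: "L-lipschitz_on UNIV g" and L: "0 < L"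
    and a0: "L0-lipschitz_on {0..r} a0" and b0: "L0-lipschitz_on {0..r} b0"
  obtains a b where "is_Lipschitz_on (Square r) a" "is_Lipschitz_on (Square r) b"
    "solves_Goursat r f g a0 b0 a b"
proof -
  have fg: "continuous_on UNIV f" "continuous_on UNIV g"
    and ab0: "continuous_on {0..r} a0" "continuous_on {0..r} b0"
    using f g a0 b0 by (auto intro: lipschitz_on_continuous_on)
  obtain u where u: "continuous_on (Square r) u"
    and u_fix: "\<And>p. p \<in> Square r \<Longrightarrow> u p = Picard f g a0 b0 u p"
    using Picard_fixpoint[OF f g L ab0] by blast
  define a where "a = fst \<circ> u"
  define b where "b = snd \<circ> u"
  have cont: "continuous_on (Square r) a" "continuous_on (Square r) b"
    using u by (auto simp: a_def b_def intro!: continuous_intros)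
  have u_eq: "u p = (a p, b p)" for p by (simp add: a_def b_def)
  have a: "a (x, y) = a0 x + integral {0..y} (\<lambda>t. f (a (x, t), b (x, t)))"
    and b: "b (x, y) = b0 y + integral {0..x} (\<lambda>s. g (a (s, y), b (s, y)))"
    if "(x, y) \<in> Square r" for x y
    using u_fix[OF that] by (auto simp: Picard_def u_eq)
  have contf: "continuous_on (Square r) (\<lambda>p. f (a p, b p))" and contg: "continuous_on (Square r) (\<lambda>p. g (a p, b p))"
    by (auto intro!: continuous_on_compose2[OF fg(1)] continuous_on_compose2[OF fg(2)] continuous_intros cont)
  have cpt: "compact (Square r)" by (auto simp: Square_def intro: compact_Times)
  have "bounded ((\<lambda>p. f (a p, b p)) ` Square r)" "bounded ((\<lambda>p. g (a p, b p)) ` Square r)"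
    by (intro compact_imp_bounded compact_continuous_image contf contg cpt)+
  then have "bounded ((\<lambda>p. f (a p, b p)) ` Square r \<union> (\<lambda>p. g (a p, b p)) ` Square r)" by simp
  then obtain M where M: "0 < M" "\<And>p. p \<in> Square r \<Longrightarrow> norm (f (a p, b p)) \<le> M"
     "\<And>p. p \<in> Square r \<Longrightarrow> norm (g (a p, b p)) \<le> M"
    unfolding bounded_pos by auto
  have da: "((\<lambda>t. a (x, t)) has_vector_derivative f (a (x, y), b (x, y))) (at y within {0..r})"
    and db: "((\<lambda>s. b (s, y)) has_vector_derivative g (a (x, y), b (x, y))) (at x within {0..r})"
    if "x \<in> {0..r}" "y \<in> {0..r}" for x y
  proof -
    have "continuous_on {0..r} (\<lambda>t. f (a (x, t), b (x, t)))"
      by (rule continuous_on_compose2[OF contf]) (use that in \<open>auto intro!: continuous_intros simp: Square_def\<close>)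
    from integral_has_vector_derivative[OF this that(2)]
    have "((\<lambda>t. a0 x + integral {0..t} (\<lambda>t. f (a (x, t), b (x, t)))) has_vector_derivative
        f (a (x, y), b (x, y))) (at y within {0..r})"
      using has_vector_derivative_add[OF has_vector_derivative_const] by fastforce
    then show "((\<lambda>t. a (x, t)) has_vector_derivative f (a (x, y), b (x, y))) (at y within {0..r})"
      by (rule has_vector_derivative_transform[rotated 2]) (use that a in \<open>auto simp: Square_def\<close>)
    have "continuous_on {0..r} (\<lambda>s. g (a (s, y), b (s, y)))"
      by (rule continuous_on_compose2[OF contg]) (use that in \<open>auto intro!: continuous_intros simp: Square_def\<close>)
    from integral_has_vector_derivative[OF this that(1)]
    have "((\<lambda>s. b0 y + integral {0..s} (\<lambda>s. g (a (s, y), b (s, y)))) has_vector_derivative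
        g (a (x, y), b (x, y))) (at x within {0..r})"
      using has_vector_derivative_add[OF has_vector_derivative_const] by fastforce
    then show "((\<lambda>s. b (s, y)) has_vector_derivative g (a (x, y), b (x, y))) (at x within {0..r})"
      by (rule has_vector_derivative_transform[rotated 2]) (use that b in \<open>auto simp: Square_def\<close>)
  qed
  have a_y: "M-lipschitz_on {0..r} (\<lambda>t. a (x, t))" if "x \<in> {0..r}" for x
    using that M by (intro has_vector_derivative_imp_lipschitz_on[OF da]) (auto simp: Square_def)
  have b_x: "M-lipschitz_on {0..r} (\<lambda>s. b (s, y))" if "y \<in> {0..r}" for y
    using that M by (intro has_vector_derivative_imp_lipschitz_on[OF db]) (auto simp: Square_def)
  obtain K where a_x: "\<And>y. y \<in> {0..r} \<Longrightarrow> K-lipschitz_on {0..r} (\<lambda>x. a (x, y))"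
    using lipschitz_fst_of_integral_equation[OF f L a0 cont a b_x] by blast
  \<comment> \<open>The transverse bound for \<open>b\<close> is the one for \<open>a\<close> after
    exchanging the coordinates and the two unknowns, so both the points and the arguments of
    \<open>g\<close> are swapped.\<close>
  have gs: "L-lipschitz_on UNIV (\<lambda>p. g (prod.swap p))"
    using g by (auto simp: lipschitz_on_def dist_Pair_Pair) (metis add.commute)
  have cont_swap: "continuous_on (Square r) (\<lambda>p. b (prod.swap p))" "continuous_on (Square r) (\<lambda>p. a (prod.swap p))"
    by (rule continuous_on_compose2[OF cont(2)] continuous_on_compose2[OF cont(1)];
        auto intro!: continuous_intros simp: Square_def)+
  obtain K' where "\<And>x. x \<in> {0..r} \<Longrightarrow> K'-lipschitz_on {0..r} (\<lambda>y. b (prod.swap (y, x)))"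
  proof (rule lipschitz_fst_of_integral_equation[OF gs L b0 cont_swap, of M])
    show "b (prod.swap (y, x)) = b0 y + integral {0..x} (\<lambda>t. g (prod.swap (b (prod.swap (y, t)), a (prod.swap (y, t)))))"
      if "(y, x) \<in> Square r" for y x
      using b[of x y] that by (auto simp: Square_def)
  qed (use a_y in auto)
  then have b_y: "\<And>x. x \<in> {0..r} \<Longrightarrow> K'-lipschitz_on {0..r} (\<lambda>y. b (x, y))" by simp
  show ?thesis
  proof (rule that)
    show "is_Lipschitz_on (Square r) a" by (rule lipschitz_on_Square[OF a_x a_y])
    show "is_Lipschitz_on (Square r) b" by (rule lipschitz_on_Square[OF b_x b_y])
    show "solves_Goursat r f g a0 b0 a b"
      using da db a[of _ 0] b[of 0] by (auto simp: solves_Goursat_def Square_def)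
  qed
qed

section \<open>Uniform estimates near compact sets\<close>

lemma compact_insert_sequence_limit:
  fixes q :: "nat \<Rightarrow> 'a::topological_space"
  assumes "q \<longlonglongrightarrow> p"
  shows "compact (insert p (range q))"
proof (rule compactI)
  fix C :: "'a set set"
  assume op: "\<forall>t\<in>C. open t" and cov: "insert p (range q) \<subseteq> \<Union>C"
  then obtain U where U: "U \<in> C" "p \<in> U" by auto
  then obtain N where N: "\<And>n. n \<ge> N \<Longrightarrow> q n \<in> U"
    using topological_tendstoD[OF assms, of U] op by (auto simp: eventually_sequentially)
  obtain V where V: "\<And>n. V n \<in> C \<and> q n \<in> V n"
    using cov by (simp add: subset_eq) metis
  have "insert p (range q) \<subseteq> \<Union>(insert U (V ` {..<N}))"
    using U N V by (force simp: not_less[symmetric])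
  moreover have "insert U (V ` {..<N}) \<subseteq> C" using U V by auto
  ultimately show "\<exists>C'\<subseteq>C. finite C' \<and> insert p (range q) \<subseteq> \<Union>C'" by blast
qed

text \<open>A Lebesgue number argument, for any estimate inherited by smaller sets and larger
  constants. The cover uses half radii: a ball of radius \<open>D\<close> around any point of
  \<open>K\<close> then still fits into the full ball of one of the finitely many centres.\<close>

lemma compact_uniform_ball:
  fixes P :: "'a::metric_space set \<Rightarrow> real \<Rightarrow> bool"
  assumes K: "compact K" and loc: "\<And>p. p \<in> K \<Longrightarrow> \<exists>d>0. \<exists>C. P (ball p d) C"
    and mono: "\<And>S T C D. P S C \<Longrightarrow> T \<subseteq> S \<Longrightarrow> C \<le> D \<Longrightarrow> P T D"
  obtains d C where "0 < d" "0 \<le> C" "\<And>p. p \<in> K \<Longrightarrow> P (ball p d) C"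
proof -
  obtain d C where dC: "\<And>p. p \<in> K \<Longrightarrow> 0 < d p \<and> P (ball p (d p)) (C p)"
    using loc by metis
  have "K \<subseteq> (\<Union>p\<in>K. ball p (d p / 2))"
    using dC by fastforce
  then obtain T where T: "T \<subseteq> K" "finite T" "K \<subseteq> (\<Union>p\<in>T. ball p (d p / 2))"
    using compactE_image[OF K, of K "\<lambda>p. ball p (d p / 2)"] by auto
  \<comment> \<open>The inserted 1 and 0 keep \<open>Min\<close> and \<open>Max\<close> meaningful
    when \<open>T\<close> is empty.\<close>
  define D where "D = Min (insert 1 ((\<lambda>p. d p / 2) ` T))"
  define B where "B = Max (insert 0 (C ` T))"
  have "0 < D" using T dC by (auto simp: D_def subset_eq)
  moreover have "0 \<le> B" using T by (auto simp: B_def)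
  moreover have "P (ball p D) B" if p: "p \<in> K" for p
  proof -
    obtain c where c: "c \<in> T" "dist c p < d c / 2" using T(3) p by auto
    have "D \<le> d c / 2" unfolding D_def using c T by (intro Min_le) auto
    moreover have "C c \<le> B" unfolding B_def using c T by (intro Max_ge) auto
    moreover have "dist c z < d c" if "dist p z < D" for z
      using dist_triangle[of c z p] that c \<open>D \<le> d c / 2\<close> by linarith
    ultimately show ?thesis
      using mono[of "ball c (d c)" "C c" "ball p D" B] dC c T by (auto simp: subset_eq)
  qed
  ultimately show ?thesis by (rule that)
qed

lemma mesh_sizes_pos: "\<epsilon> \<in> mesh_sizes \<epsilon>0 \<Longrightarrow> 0 < \<epsilon>"
  by (auto simp: mesh_sizes_def)

text \<open>Otherwise there would be points \<open>q n \<longlonglongrightarrow> p\<close> violating the estimate with constant \<open>n\<close>; but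
  they form, together with \<open>p\<close>, a compact set. This is what makes uniformity on compact sets
  sufficient in infinite dimensions.\<close>

lemma O_eps_on_compact_imp_local:
  fixes h :: "'a::metric_space \<Rightarrow> 'v::real_normed_vector"
  assumes "\<And>K. compact K \<Longrightarrow> eq_up_to_O_eps \<epsilon>0 (\<lambda>_. K) h\<epsilon> h"
  shows "\<exists>d>0. \<exists>C. \<forall>\<epsilon>\<in>mesh_sizes \<epsilon>0. \<forall>q\<in>ball p d. norm (h\<epsilon> \<epsilon> q - h q) \<le> C * \<epsilon>"
proof (rule ccontr)
  assume neg: "\<not> ?thesis"
  have "\<exists>\<epsilon> q. \<epsilon> \<in> mesh_sizes \<epsilon>0 \<and> q \<in> ball p (1 / Suc n) \<and> real n * \<epsilon> < norm (h\<epsilon> \<epsilon> q - h q)" for n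
  proof -
    have "0 < 1 / real (Suc n)" by simp
    with neg show ?thesis by (meson not_le)
  qed
  then obtain \<epsilon> q where \<epsilon>: "\<And>n. \<epsilon> n \<in> mesh_sizes \<epsilon>0" and q: "\<And>n. q n \<in> ball p (1 / Suc n)"
    and bad: "\<And>n. real n * \<epsilon> n < norm (h\<epsilon> (\<epsilon> n) (q n) - h (q n))"
    by metis
  have "q \<longlonglongrightarrow> p"
  proof (rule metric_LIMSEQ_I)
    fix e :: real assume "0 < e"
    then obtain N where N: "inverse (real (Suc N)) < e" using reals_Archimedean by blast
    have "dist (q n) p < e" if "n \<ge> N" for n
    proof -
      have "dist (q n) p < 1 / Suc n" using q[of n] by (simp add: dist_commute)
      also have "\<dots> \<le> inverse (real (Suc N))" using that by (simp add: field_simps)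
      finally show ?thesis using N by simp
    qed
    then show "\<exists>N. \<forall>n\<ge>N. dist (q n) p < e" by blast
  qed
  from assms[OF compact_insert_sequence_limit[OF this]]
  obtain C where C: "\<And>n. norm (h\<epsilon> (\<epsilon> n) (q n) - h (q n)) \<le> C * \<epsilon> n"
    using \<epsilon> by (fastforce simp: eq_up_to_O_eps_def)
  obtain n :: nat where "C \<le> real n" using real_arch_simple by blast
  then have "C * \<epsilon> n \<le> real n * \<epsilon> n"
    using mesh_sizes_pos[OF \<epsilon>] by (intro mult_right_mono) (auto intro: less_imp_le)
  then show False using C[of n] bad[of n] by linarith
qed

text \<open>A neighbourhood of \<open>K\<close> of fixed radius is in general not compact, so
  uniformity on compact sets says nothing about it directly. Instead both estimates are established
  locally around each point and then made uniform over \<open>K\<close>.\<close>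

lemma C1_approximation_near_compact:
  fixes h :: "'v::real_normed_vector \<times> 'v \<Rightarrow> 'v"
  assumes h: "C1_on UNIV h" and approx: "C1_approximation \<epsilon>0 h\<epsilon> h" and "compact K"
  obtains d C where "0 < d" "0 \<le> C"
    "\<And>p q. p \<in> K \<Longrightarrow> norm (q - p) < d \<Longrightarrow> norm (h q - h p) \<le> C * norm (q - p)"
    "\<And>\<epsilon> p q. p \<in> K \<Longrightarrow> norm (q - p) < d \<Longrightarrow> \<epsilon> \<in> mesh_sizes \<epsilon>0 \<Longrightarrow> norm (h\<epsilon> \<epsilon> q - h q) \<le> C * \<epsilon>"
proof -
  \<comment> \<open>Both estimates go into one predicate, so that one radius and one constant serve
    for both.\<close>
  define P where "P S C \<longleftrightarrow> (\<forall>q\<in>S. \<forall>q'\<in>S. norm (h q - h q') \<le> C * norm (q - q')) \<and>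
     (\<forall>\<epsilon>\<in>mesh_sizes \<epsilon>0. \<forall>q\<in>S. norm (h\<epsilon> \<epsilon> q - h q) \<le> C * \<epsilon>)" for S C
  have mono: "P T D" if "P S C" "T \<subseteq> S" "C \<le> D" for S T C D
    unfolding P_def
  proof (intro conjI ballI)
    fix q q' assume "q \<in> T" "q' \<in> T"
    then have "norm (h q - h q') \<le> C * norm (q - q')" using that unfolding P_def by blast
    also have "\<dots> \<le> D * norm (q - q')" using that by (intro mult_right_mono) auto
    finally show "norm (h q - h q') \<le> D * norm (q - q')" .
  next
    fix \<epsilon> q assume "\<epsilon> \<in> mesh_sizes \<epsilon>0" "q \<in> T"
    then have "norm (h\<epsilon> \<epsilon> q - h q) \<le> C * \<epsilon>" using that unfolding P_def by blast
    also have "\<dots> \<le> D * \<epsilon>"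
      using that mesh_sizes_pos[OF \<open>\<epsilon> \<in> _\<close>] by (intro mult_right_mono) auto
    finally show "norm (h\<epsilon> \<epsilon> q - h q) \<le> D * \<epsilon>" .
  qed
  have loc: "\<exists>d>0. \<exists>C. P (ball p d) C" for p
  proof -
    obtain d1 C1 where 1: "0 < d1" "C1-lipschitz_on (ball p d1) h"
      using C1_on_imp_local_lipschitz_on[OF h] by blast
    obtain d2 C2 where 2: "0 < d2" "\<forall>\<epsilon>\<in>mesh_sizes \<epsilon>0. \<forall>q\<in>ball p d2. norm (h\<epsilon> \<epsilon> q - h q) \<le> C2 * \<epsilon>"
      using O_eps_on_compact_imp_local[of \<epsilon>0 h\<epsilon> h p] approx by (auto simp: C1_approximation_def)
    have "P (ball p (min d1 d2)) (max C1 C2)"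
      unfolding P_def
    proof (intro conjI ballI)
      fix q q' assume "q \<in> ball p (min d1 d2)" "q' \<in> ball p (min d1 d2)"
      then have "norm (h q - h q') \<le> C1 * norm (q - q')"
        using lipschitz_onD[OF 1(2), of q q'] by (simp add: dist_norm)
      also have "\<dots> \<le> max C1 C2 * norm (q - q')" by (intro mult_right_mono) auto
      finally show "norm (h q - h q') \<le> max C1 C2 * norm (q - q')" .
    next
      fix \<epsilon> q assume "\<epsilon> \<in> mesh_sizes \<epsilon>0" "q \<in> ball p (min d1 d2)"
      then have "norm (h\<epsilon> \<epsilon> q - h q) \<le> C2 * \<epsilon>" using 2 by auto
      also have "\<dots> \<le> max C1 C2 * \<epsilon>"
        using mesh_sizes_pos[OF \<open>\<epsilon> \<in> _\<close>] by (intro mult_right_mono) auto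
      finally show "norm (h\<epsilon> \<epsilon> q - h q) \<le> max C1 C2 * \<epsilon>" .
    qed
    with 1 2 show ?thesis by (metis min_less_iff_conj)
  qed
  show ?thesis
  proof (rule compact_uniform_ball[of K P, OF \<open>compact K\<close> loc mono])
    fix d C assume dC: "0 < d" "0 \<le> C" and P: "\<And>p. p \<in> K \<Longrightarrow> P (ball p d) C"
    have *: "norm (h q - h p) \<le> C * norm (q - p)"
      "\<And>\<epsilon>. \<epsilon> \<in> mesh_sizes \<epsilon>0 \<Longrightarrow> norm (h\<epsilon> \<epsilon> q - h q) \<le> C * \<epsilon>"
      if "p \<in> K" "norm (q - p) < d" for p q
    proof -
      have "p \<in> ball p d" "q \<in> ball p d"
        using that \<open>0 < d\<close> by (auto simp: dist_norm norm_minus_commute)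
      with P[OF \<open>p \<in> K\<close>] show "norm (h q - h p) \<le> C * norm (q - p)"
        "\<And>\<epsilon>. \<epsilon> \<in> mesh_sizes \<epsilon>0 \<Longrightarrow> norm (h\<epsilon> \<epsilon> q - h q) \<le> C * \<epsilon>"
        unfolding P_def by blast+
    qed
    show ?thesis by (rule that[OF dC]) (fact *)+
  qed
qed

section \<open>Propagation of the discretisation error\<close>

text \<open>A bootstrap: the one-step estimates are available only while the errors add up to less
  than \<open>d\<close>, and the bound being proved guarantees this at the preceding point. The
  induction runs over \<open>i + j\<close> because \<open>E\<close> advances in \<open>j\<close> and
  \<open>F\<close> in \<open>i\<close>, each using both errors at a point of the preceding
  antidiagonal.\<close>

lemma discrete_Gronwall:
  fixes E F :: "nat \<Rightarrow> nat \<Rightarrow> real"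
  assumes \<epsilon>: "0 < \<epsilon>" and L: "0 \<le> L" and A: "0 \<le> A"
    and E0: "\<And>i. \<epsilon> * real i \<le> \<rho> \<Longrightarrow> E i 0 \<le> A * \<epsilon>"
    and F0: "\<And>j. \<epsilon> * real j \<le> \<rho> \<Longrightarrow> F 0 j \<le> A * \<epsilon>"
    and E: "\<And>i j. \<epsilon> * real i \<le> \<rho> \<Longrightarrow> \<epsilon> * real (Suc j) \<le> \<rho> \<Longrightarrow> E i j + F i j < d \<Longrightarrow>
        E i (Suc j) \<le> E i j + \<epsilon> * (L * (E i j + F i j) + A * \<epsilon>)"
    and F: "\<And>i j. \<epsilon> * real (Suc i) \<le> \<rho> \<Longrightarrow> \<epsilon> * real j \<le> \<rho> \<Longrightarrow> E i j + F i j < d \<Longrightarrow>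
        F (Suc i) j \<le> F i j + \<epsilon> * (L * (E i j + F i j) + A * \<epsilon>)"
    and small: "2 * (A * \<epsilon> * exp ((2 * L + 1) * (2 * \<rho>))) < d"
    and "\<epsilon> * real i \<le> \<rho>" "\<epsilon> * real j \<le> \<rho>"
  shows "E i j \<le> A * \<epsilon> * exp ((2 * L + 1) * (\<epsilon> * real (i + j))) \<and>
         F i j \<le> A * \<epsilon> * exp ((2 * L + 1) * (\<epsilon> * real (i + j)))"
  using assms(9,10)
proof (induction "i + j" arbitrary: i j rule: less_induct)
  case less
  let ?b = "\<lambda>n. A * \<epsilon> * exp ((2 * L + 1) * (\<epsilon> * real n))"
  have init: "A * \<epsilon> \<le> ?b n" for n
    using \<epsilon> L A mult_left_mono[of 1 "exp ((2 * L + 1) * (\<epsilon> * real n))" "A * \<epsilon>"] by simp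
  \<comment> \<open>Origin of \<open>2 * L + 1\<close>: the two errors give \<open>2 * L\<close>,
    and the consistency term gives 1, since \<open>init\<close> bounds \<open>A * \<epsilon>\<close>
    by \<open>?b n\<close>.\<close>
  have step: "e + \<epsilon> * (L * (e + e') + A * \<epsilon>) \<le> ?b (Suc n)" if "e \<le> ?b n" "e' \<le> ?b n" for e e' n
  proof -
    have "e + \<epsilon> * (L * (e + e') + A * \<epsilon>) \<le> ?b n + \<epsilon> * (L * (?b n + ?b n) + ?b n)"
      using that \<epsilon> L init by (intro add_mono mult_left_mono) auto
    also have "\<dots> = ?b n * (1 + (2 * L + 1) * \<epsilon>)" by (simp add: algebra_simps)
    also have "\<dots> \<le> ?b n * exp ((2 * L + 1) * \<epsilon>)"
      using A \<epsilon> by (intro mult_left_mono exp_ge_add_one_self) auto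
    also have "\<dots> = ?b (Suc n)" by (simp add: exp_add[symmetric] algebra_simps)
    finally show ?thesis .
  qed
  \<comment> \<open>At most \<open>2 * \<rho>\<close> is covered by \<open>k + l\<close> mesh steps
    inside the square, so \<open>small\<close> bounds the sum of both errors.\<close>
  have near: "e + e' < d" if "e \<le> ?b (k + l)" "e' \<le> ?b (k + l)" "\<epsilon> * real k \<le> \<rho>" "\<epsilon> * real l \<le> \<rho>" for e e' k l
  proof -
    have "(2 * L + 1) * (\<epsilon> * real (k + l)) \<le> (2 * L + 1) * (2 * \<rho>)"
      using that L by (intro mult_left_mono) (auto simp: distrib_left)
    then have "?b (k + l) \<le> A * \<epsilon> * exp ((2 * L + 1) * (2 * \<rho>))"
      using A \<epsilon> by (intro mult_left_mono) auto
    then show ?thesis using that small by linarith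
  qed
  have "E i j \<le> ?b (i + j)"
  proof (cases j)
    case 0
    then show ?thesis using E0[of i] init[of i] less.prems by simp
  next
    case (Suc l)
    then have l: "\<epsilon> * real l \<le> \<rho>"
      using less.prems(2) \<epsilon> by (simp add: distrib_left)
    have IH: "E i l \<le> ?b (i + l)" "F i l \<le> ?b (i + l)"
      using less.hyps[of i l] less.prems(1) l Suc by auto
    show ?thesis
      using E[of i l] near[OF IH less.prems(1) l] step[OF IH] less.prems Suc by simp
  qed
  moreover have "F i j \<le> ?b (i + j)"
  proof (cases i)
    case 0
    then show ?thesis using F0[of j] init[of j] less.prems by simp
  next
    case (Suc k)
    then have k: "\<epsilon> * real k \<le> \<rho>"
      using less.prems(1) \<epsilon> by (simp add: distrib_left)
    have IH: "E k j \<le> ?b (k + j)" "F k j \<le> ?b (k + j)"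
      using less.hyps[of k j] less.prems(2) k Suc by auto
    show ?thesis
      using F[of k j] near[OF IH k less.prems(2)] step[OF IH(2,1)] less.prems Suc
      by (simp add: add.commute)
  qed
  ultimately show ?case by blast
qed

text \<open>An explicit Euler step \<open>W + \<epsilon> *\<^sub>R h\<epsilon> v\<close> against the
  exact value. Here \<open>u\<close> and \<open>v\<close> are the full exact and discrete pairs,
  while \<open>w\<close> and \<open>W\<close> are the component being advanced. Three defects are
  added: \<open>h\<epsilon>\<close> against \<open>h\<close>, \<open>v\<close> against
  \<open>u y\<close>, and the variation of \<open>h (u t)\<close> during the step.\<close>

lemma one_step_error:
  fixes w :: "real \<Rightarrow> 'v::real_normed_vector" and u :: "real \<Rightarrow> 'w::real_normed_vector"
  assumes \<epsilon>: "0 < \<epsilon>" and "0 \<le> C"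
    and w: "\<And>t. t \<in> {y..y + \<epsilon>} \<Longrightarrow> (w has_vector_derivative h (u t)) (at t within {y..y + \<epsilon>})"
    and u: "\<And>t. t \<in> {y..y + \<epsilon>} \<Longrightarrow> norm (u t - u y) \<le> \<Lambda> * \<epsilon>" and "\<Lambda> * \<epsilon> < d"
    and h: "\<And>q. norm (q - u y) < d \<Longrightarrow> norm (h q - h (u y)) \<le> C * norm (q - u y)"
    and h\<epsilon>: "\<And>q. norm (q - u y) < d \<Longrightarrow> norm (h\<epsilon> q - h q) \<le> C * \<epsilon>"
    and v: "norm (v - u y) < d"
  shows "norm (W + \<epsilon> *\<^sub>R h\<epsilon> v - w (y + \<epsilon>)) \<le>
    norm (W - w y) + \<epsilon> * (C * norm (v - u y) + (C + C * \<Lambda>) * \<epsilon>)"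
proof -
  \<comment> \<open>The linearisation error is the step length times the oscillation of the
    derivative \<open>h (u t)\<close>, which is at most \<open>C * (\<Lambda> * \<epsilon>)\<close>;
    \<open>\<Lambda> * \<epsilon> < d\<close> keeps \<open>u t\<close> where \<open>h\<close> is
    controlled.\<close>
  have "norm (w (y + \<epsilon>) - w y - (y + \<epsilon> - y) *\<^sub>R h (u y)) \<le> norm (y + \<epsilon> - y) * (C * (\<Lambda> * \<epsilon>))"
  proof (rule vector_differentiable_bound_linearization[where S = "{y..y + \<epsilon>}" and f' = "\<lambda>t. h (u t)"])
    fix t assume t: "t \<in> {y..y + \<epsilon>}"
    have "norm (h (u t) - h (u y)) \<le> C * norm (u t - u y)"
      using h[of "u t"] u[OF t] \<open>\<Lambda> * \<epsilon> < d\<close> by simp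
    also have "\<dots> \<le> C * (\<Lambda> * \<epsilon>)" using u[OF t] \<open>0 \<le> C\<close> by (intro mult_left_mono)
    finally show "norm (h (u t) - h (u y)) \<le> C * (\<Lambda> * \<epsilon>)" .
  qed (use w \<epsilon> in \<open>auto simp: closed_segment_eq_real_ivl\<close>)
  then have 1: "norm (w (y + \<epsilon>) - w y - \<epsilon> *\<^sub>R h (u y)) \<le> \<epsilon> * (C * \<Lambda> * \<epsilon>)"
    using \<epsilon> by (simp add: mult.assoc)
  have 2: "norm (h\<epsilon> v - h (u y)) \<le> C * \<epsilon> + C * norm (v - u y)"
    using norm_triangle_le[of "h\<epsilon> v - h v" "h v - h (u y)"] h[OF v] h\<epsilon>[OF v] by force
  have "W + \<epsilon> *\<^sub>R h\<epsilon> v - w (y + \<epsilon>) =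
      (W - w y) + (\<epsilon> *\<^sub>R (h\<epsilon> v - h (u y)) - (w (y + \<epsilon>) - w y - \<epsilon> *\<^sub>R h (u y)))"
    by (simp add: algebra_simps)
  also have "norm \<dots> \<le> norm (W - w y) +
      (norm (\<epsilon> *\<^sub>R (h\<epsilon> v - h (u y))) + norm (w (y + \<epsilon>) - w y - \<epsilon> *\<^sub>R h (u y)))"
    by (intro norm_triangle_le add_left_mono norm_triangle_ineq4)
  also have "\<dots> \<le> norm (W - w y) + (\<epsilon> * (C * \<epsilon> + C * norm (v - u y)) + \<epsilon> * (C * \<Lambda> * \<epsilon>))"
    using 1 2 \<epsilon> by (intro add_mono) auto
  finally show ?thesis by (simp add: algebra_simps)
qed

section \<open>Finiteness of grids and of the coarse mesh sizes\<close>

lemma finite_grid: "0 < \<epsilon> \<Longrightarrow> finite (grid \<epsilon> \<rho>)"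
proof -
  assume \<epsilon>: "0 < \<epsilon>"
  have "grid \<epsilon> \<rho> \<subseteq> (\<lambda>n. \<epsilon> * of_int n) ` {0..\<lfloor>\<rho> / \<epsilon>\<rfloor>}"
    using \<epsilon> by (auto simp: grid_def le_floor_iff field_simps zero_le_mult_iff)
  then show ?thesis by (rule finite_subset) auto
qed

lemma gridE:
  assumes "x \<in> grid \<epsilon> \<rho>" "0 < \<epsilon>"
  obtains i :: nat where "x = \<epsilon> * real i" "\<epsilon> * real i \<le> \<rho>"
proof -
  obtain n :: int where n: "x = \<epsilon> * of_int n" "0 \<le> x" "x \<le> \<rho>"
    using assms by (auto simp: grid_def)
  then have "0 \<le> n" using assms by (simp add: zero_le_mult_iff)
  then obtain i where "n = int i" by (rule nonneg_int_cases)
  with n show ?thesis by (intro that[of i]) auto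
qed

lemma gridI: "0 < \<epsilon> \<Longrightarrow> \<epsilon> * real i \<le> \<rho> \<Longrightarrow> \<epsilon> * real i \<in> grid \<epsilon> \<rho>"
  by (auto simp: grid_def intro: image_eqI[of _ _ "int i"])

text \<open>Powers of 1/2 accumulate only at 0. For a continuum of mesh sizes this would
  fail.\<close>

lemma finite_coarse_mesh_sizes:
  assumes "0 < \<epsilon>1"
  shows "finite {\<epsilon> \<in> mesh_sizes \<epsilon>0. \<epsilon>1 < \<epsilon>}"
proof -
  obtain N where N: "(1 / 2 :: real) ^ N < \<epsilon>1"
    using real_arch_pow_inv[OF assms, of "1/2"] by auto
  have "{\<epsilon> \<in> mesh_sizes \<epsilon>0. \<epsilon>1 < \<epsilon>} \<subseteq> (\<lambda>k. 1 / 2 ^ k) ` {..N}"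
  proof
    fix \<epsilon> assume "\<epsilon> \<in> {\<epsilon> \<in> mesh_sizes \<epsilon>0. \<epsilon>1 < \<epsilon>}"
    then obtain k :: nat where k: "\<epsilon> = 1 / 2 ^ k" "\<epsilon>1 < \<epsilon>" by (auto simp: mesh_sizes_def)
    have "k \<le> N"
    proof (rule ccontr)
      assume "\<not> k \<le> N"
      then have "(1 / 2 :: real) ^ k \<le> (1 / 2) ^ N" by (intro power_decreasing) auto
      with k N show False by (simp add: power_one_over)
    qed
    with k show "\<epsilon> \<in> (\<lambda>k. 1 / 2 ^ k) ` {..N}" by auto
  qed
  then show ?thesis by (rule finite_subset) auto
qed

lemma eq_up_to_O_eps_of_small:
  assumes \<epsilon>1: "0 < \<epsilon>1" and fin: "\<And>\<epsilon>. \<epsilon> \<in> mesh_sizes \<epsilon>0 \<Longrightarrow> finite (D \<epsilon>)"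
    and C: "\<And>\<epsilon> p. \<epsilon> \<in> mesh_sizes \<epsilon>0 \<Longrightarrow> \<epsilon> \<le> \<epsilon>1 \<Longrightarrow> p \<in> D \<epsilon> \<Longrightarrow> norm (u \<epsilon> p - v p) \<le> C * \<epsilon>"
  shows "eq_up_to_O_eps \<epsilon>0 D u v"
proof -
  let ?F = "{\<epsilon> \<in> mesh_sizes \<epsilon>0. \<epsilon>1 < \<epsilon>}"
  \<comment> \<open>All quotients are nonnegative, so their sum dominates each of them; unlike a
    maximum it needs no case for empty sets.\<close>
  define B where "B = (\<Sum>\<epsilon>\<in>?F. \<Sum>p\<in>D \<epsilon>. norm (u \<epsilon> p - v p) / \<epsilon>)"
  have pos: "0 \<le> norm (u \<epsilon> p - v p) / \<epsilon>" if "\<epsilon> \<in> mesh_sizes \<epsilon>0" for \<epsilon> p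
    using mesh_sizes_pos[OF that] by simp
  have "norm (u \<epsilon> p - v p) \<le> max C B * \<epsilon>" if \<epsilon>: "\<epsilon> \<in> mesh_sizes \<epsilon>0" and p: "p \<in> D \<epsilon>" for \<epsilon> p
  proof (cases "\<epsilon> \<le> \<epsilon>1")
    case True
    note C[OF \<epsilon> True p]
    also have "C * \<epsilon> \<le> max C B * \<epsilon>"
      using mesh_sizes_pos[OF \<epsilon>] by (intro mult_right_mono) auto
    finally show ?thesis .
  next
    case False
    have "norm (u \<epsilon> p - v p) / \<epsilon> \<le> (\<Sum>p\<in>D \<epsilon>. norm (u \<epsilon> p - v p) / \<epsilon>)"
      using fin[OF \<epsilon>] p pos[OF \<epsilon>] by (intro member_le_sum) auto
    also have "\<dots> \<le> B"
      unfolding B_def using finite_coarse_mesh_sizes[OF \<epsilon>1] \<epsilon> False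
      by (intro member_le_sum[of \<epsilon> ?F "\<lambda>\<epsilon>. \<Sum>p\<in>D \<epsilon>. norm (u \<epsilon> p - v p) / \<epsilon>"] sum_nonneg pos) auto
    finally have "norm (u \<epsilon> p - v p) / \<epsilon> \<le> max C B" by simp
    then show ?thesis using mesh_sizes_pos[OF \<epsilon>] by (simp add: field_simps)
  qed
  then show ?thesis unfolding eq_up_to_O_eps_def by blast
qed

section \<open>Comparison of the discrete with the continuous solution\<close>

lemma discrete_step_y:
  assumes "solves_discrete_Goursat \<epsilon> r f g a0 b0 a b" "0 < \<epsilon>"
    and "\<epsilon> * real i \<le> r" "\<epsilon> * real (Suc j) \<le> r"
  shows "a (\<epsilon> * real i, \<epsilon> * real (Suc j)) = a (\<epsilon> * real i, \<epsilon> * real j) +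
     \<epsilon> *\<^sub>R f (a (\<epsilon> * real i, \<epsilon> * real j), b (\<epsilon> * real i, \<epsilon> * real j))"
proof -
  have "\<epsilon> * real j \<le> r" and eq: "\<epsilon> * real j + \<epsilon> = \<epsilon> * real (Suc j)"
    using assms by (auto simp: algebra_simps)
  then have "(\<epsilon> * real i, \<epsilon> * real j) \<in> Grid2 \<epsilon> r" "(\<epsilon> * real i, \<epsilon> * real j + \<epsilon>) \<in> Grid2 \<epsilon> r"
    unfolding eq Grid2_def using gridI[of \<epsilon>] assms by blast+
  then have "diff_y \<epsilon> a (\<epsilon> * real i, \<epsilon> * real j) = f (a (\<epsilon> * real i, \<epsilon> * real j), b (\<epsilon> * real i, \<epsilon> * real j))"
    using assms(1) by (auto simp: solves_discrete_Goursat_def)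
  then have "\<epsilon> *\<^sub>R f (a (\<epsilon> * real i, \<epsilon> * real j), b (\<epsilon> * real i, \<epsilon> * real j)) =
      \<epsilon> *\<^sub>R diff_y \<epsilon> a (\<epsilon> * real i, \<epsilon> * real j)" by simp
  also have "\<dots> = a (\<epsilon> * real i, \<epsilon> * real j + \<epsilon>) - a (\<epsilon> * real i, \<epsilon> * real j)"
    using \<open>0 < \<epsilon>\<close> by (simp add: diff_y_def)
  finally show ?thesis unfolding eq by simp
qed

lemma discrete_step_x:
  assumes "solves_discrete_Goursat \<epsilon> r f g a0 b0 a b" "0 < \<epsilon>"
    and "\<epsilon> * real (Suc i) \<le> r" "\<epsilon> * real j \<le> r"
  shows "b (\<epsilon> * real (Suc i), \<epsilon> * real j) = b (\<epsilon> * real i, \<epsilon> * real j) +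
     \<epsilon> *\<^sub>R g (a (\<epsilon> * real i, \<epsilon> * real j), b (\<epsilon> * real i, \<epsilon> * real j))"
proof -
  have "\<epsilon> * real i \<le> r" and eq: "\<epsilon> * real i + \<epsilon> = \<epsilon> * real (Suc i)"
    using assms by (auto simp: algebra_simps)
  then have "(\<epsilon> * real i, \<epsilon> * real j) \<in> Grid2 \<epsilon> r" "(\<epsilon> * real i + \<epsilon>, \<epsilon> * real j) \<in> Grid2 \<epsilon> r"
    unfolding eq Grid2_def using gridI[of \<epsilon>] assms by blast+
  then have "diff_x \<epsilon> b (\<epsilon> * real i, \<epsilon> * real j) = g (a (\<epsilon> * real i, \<epsilon> * real j), b (\<epsilon> * real i, \<epsilon> * real j))"
    using assms(1) by (auto simp: solves_discrete_Goursat_def)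
  then have "\<epsilon> *\<^sub>R g (a (\<epsilon> * real i, \<epsilon> * real j), b (\<epsilon> * real i, \<epsilon> * real j)) =
      \<epsilon> *\<^sub>R diff_x \<epsilon> b (\<epsilon> * real i, \<epsilon> * real j)" by simp
  also have "\<dots> = b (\<epsilon> * real i + \<epsilon>, \<epsilon> * real j) - b (\<epsilon> * real i, \<epsilon> * real j)"
    using \<open>0 < \<epsilon>\<close> by (simp add: diff_x_def)
  finally show ?thesis unfolding eq by simp
qed

text \<open>Any Lipschitz solution on a subsquare is accepted, so the local and the global claim
  differ only in how their solution is found.\<close>

lemma Goursat_convergence:
  fixes f g :: "'v::real_normed_vector \<times> 'v \<Rightarrow> 'v"
  assumes f: "C1_on UNIV f" "C1_approximation \<epsilon>0 f\<epsilon> f"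
    and g: "C1_on UNIV g" "C1_approximation \<epsilon>0 g\<epsilon> g"
    and a0: "eq_up_to_O_eps \<epsilon>0 (\<lambda>\<epsilon>. grid \<epsilon> r) a0\<epsilon> a0"
    and b0: "eq_up_to_O_eps \<epsilon>0 (\<lambda>\<epsilon>. grid \<epsilon> r) b0\<epsilon> b0"
    and disc: "\<And>\<epsilon>. \<epsilon> \<in> mesh_sizes \<epsilon>0 \<Longrightarrow>
           solves_discrete_Goursat \<epsilon> r (f\<epsilon> \<epsilon>) (g\<epsilon> \<epsilon>) (a0\<epsilon> \<epsilon>) (b0\<epsilon> \<epsilon>) (a\<epsilon> \<epsilon>) (b\<epsilon> \<epsilon>)"
    and \<rho>: "0 < \<rho>" "\<rho> \<le> r"
    and lip: "is_Lipschitz_on (Square \<rho>) a" "is_Lipschitz_on (Square \<rho>) b"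
    and sol: "solves_Goursat \<rho> f g a0 b0 a b"
  shows "converges_to_Goursat_solution \<epsilon>0 \<rho> f g a0 b0 a\<epsilon> b\<epsilon>"
proof -
  obtain La Lb where L: "La-lipschitz_on (Square \<rho>) a" "Lb-lipschitz_on (Square \<rho>) b"
    using lip by (auto simp: is_Lipschitz_on_def)
  define \<Lambda> where "\<Lambda> = La + Lb"
  define u where "u p = (a p, b p)" for p
  have \<Lambda>0: "0 \<le> \<Lambda>" using L by (auto simp: \<Lambda>_def lipschitz_on_def)
  have u_lip: "norm (u p - u q) \<le> \<Lambda> * dist p q" if "p \<in> Square \<rho>" "q \<in> Square \<rho>" for p q
    using norm_Pair_le[of "a p - a q" "b p - b q"] lipschitz_onD[OF L(1) that] lipschitz_onD[OF L(2) that]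
    by (simp add: u_def \<Lambda>_def dist_norm algebra_simps)
  have "continuous_on (Square \<rho>) u"
    unfolding u_def using L[THEN lipschitz_on_continuous_on] by (intro continuous_intros)
  moreover have "compact (Square \<rho>)" by (auto simp: Square_def intro: compact_Times)
  ultimately have K: "compact (u ` Square \<rho>)" by (rule compact_continuous_image)
  obtain d1 C1 where 1: "0 < d1" "0 \<le> C1"
    "\<And>p q. p \<in> u ` Square \<rho> \<Longrightarrow> norm (q - p) < d1 \<Longrightarrow> norm (f q - f p) \<le> C1 * norm (q - p)"
    "\<And>\<epsilon> p q. p \<in> u ` Square \<rho> \<Longrightarrow> norm (q - p) < d1 \<Longrightarrow> \<epsilon> \<in> mesh_sizes \<epsilon>0 \<Longrightarrow> norm (f\<epsilon> \<epsilon> q - f q) \<le> C1 * \<epsilon>"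
    using C1_approximation_near_compact[OF f K] by blast
  obtain d2 C2 where 2: "0 < d2" "0 \<le> C2"
    "\<And>p q. p \<in> u ` Square \<rho> \<Longrightarrow> norm (q - p) < d2 \<Longrightarrow> norm (g q - g p) \<le> C2 * norm (q - p)"
    "\<And>\<epsilon> p q. p \<in> u ` Square \<rho> \<Longrightarrow> norm (q - p) < d2 \<Longrightarrow> \<epsilon> \<in> mesh_sizes \<epsilon>0 \<Longrightarrow> norm (g\<epsilon> \<epsilon> q - g q) \<le> C2 * \<epsilon>"
    using C1_approximation_near_compact[OF g K] by blast
  define d where "d = min d1 d2"
  define C where "C = max C1 C2"
  have d: "0 < d" and C: "0 \<le> C" using 1 2 by (auto simp: d_def C_def)
  have scale: "B * t \<le> C * t" if "B \<le> C" "0 \<le> t" for B t :: real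
    using that by (rule mult_right_mono)
  have C12: "C1 \<le> C" "C2 \<le> C" by (auto simp: C_def)
  have nearf: "norm (f q - f (u p)) \<le> C * norm (q - u p)"
    and nearf\<epsilon>: "\<epsilon> \<in> mesh_sizes \<epsilon>0 \<Longrightarrow> norm (f\<epsilon> \<epsilon> q - f q) \<le> C * \<epsilon>"
    and nearg: "norm (g q - g (u p)) \<le> C * norm (q - u p)"
    and nearg\<epsilon>: "\<epsilon> \<in> mesh_sizes \<epsilon>0 \<Longrightarrow> norm (g\<epsilon> \<epsilon> q - g q) \<le> C * \<epsilon>"
    if "p \<in> Square \<rho>" "norm (q - u p) < d" for p q \<epsilon>
  proof -
    have p: "u p \<in> u ` Square \<rho>" "norm (q - u p) < d1" "norm (q - u p) < d2"
      using that by (auto simp: d_def)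
    show "norm (f q - f (u p)) \<le> C * norm (q - u p)"
      using 1(3)[OF p(1,2)] C12(1) by (rule order_trans[OF _ scale]) simp
    show "norm (g q - g (u p)) \<le> C * norm (q - u p)"
      using 2(3)[OF p(1,3)] C12(2) by (rule order_trans[OF _ scale]) simp
    assume \<epsilon>: "\<epsilon> \<in> mesh_sizes \<epsilon>0"
    show "norm (f\<epsilon> \<epsilon> q - f q) \<le> C * \<epsilon>"
      using 1(4)[OF p(1,2) \<epsilon>] C12(1) less_imp_le[OF mesh_sizes_pos[OF \<epsilon>]]
      by (rule order_trans[OF _ scale])
    show "norm (g\<epsilon> \<epsilon> q - g q) \<le> C * \<epsilon>"
      using 2(4)[OF p(1,3) \<epsilon>] C12(2) less_imp_le[OF mesh_sizes_pos[OF \<epsilon>]]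
      by (rule order_trans[OF _ scale])
  qed
  obtain Ca Cb where Ca: "\<And>\<epsilon> x. \<epsilon> \<in> mesh_sizes \<epsilon>0 \<Longrightarrow> x \<in> grid \<epsilon> r \<Longrightarrow> norm (a0\<epsilon> \<epsilon> x - a0 x) \<le> Ca * \<epsilon>"
    and Cb: "\<And>\<epsilon> y. \<epsilon> \<in> mesh_sizes \<epsilon>0 \<Longrightarrow> y \<in> grid \<epsilon> r \<Longrightarrow> norm (b0\<epsilon> \<epsilon> y - b0 y) \<le> Cb * \<epsilon>"
    using a0 b0 unfolding eq_up_to_O_eps_def by blast
  \<comment> \<open>One constant for the initial errors and for the consistency error
    \<open>C + C * \<Lambda>\<close> of a step, as the discrete Gronwall lemma expects.\<close>
  define A where "A = max (max Ca Cb) (C + C * \<Lambda>)"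
  have A: "Ca \<le> A" "Cb \<le> A" "C + C * \<Lambda> \<le> A" "0 \<le> A"
    using C \<Lambda>0 by (auto simp: A_def le_max_iff_disj)
  \<comment> \<open>The Gronwall bound at the far corner, divided by
    \<open>\<epsilon>\<close>.\<close>
  define B where "B = A * exp ((2 * C + 1) * (2 * \<rho>))"
  have B: "0 \<le> B" using A by (simp add: B_def)
  \<comment> \<open>Chosen so that \<open>\<epsilon> \<le> \<epsilon>1\<close> yields both
    \<open>\<Lambda> * \<epsilon> < d\<close>, for the exact solution within a step, and
    \<open>2 * (B * \<epsilon>) < d\<close>, for the bootstrap.\<close>
  define \<epsilon>1 where "\<epsilon>1 = d / (2 * (\<Lambda> + 2 * B + 1))"
  have \<epsilon>1: "0 < \<epsilon>1" using d \<Lambda>0 B by (simp add: \<epsilon>1_def)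
  have main: "norm (a\<epsilon> \<epsilon> p - a p) \<le> B * \<epsilon> \<and> norm (b\<epsilon> \<epsilon> p - b p) \<le> B * \<epsilon>"
    if m: "\<epsilon> \<in> mesh_sizes \<epsilon>0" and "\<epsilon> \<le> \<epsilon>1" and p: "p \<in> Grid2 \<epsilon> \<rho>" for \<epsilon> p
  proof -
    have \<epsilon>: "0 < \<epsilon>" using m by (rule mesh_sizes_pos)
    have "\<epsilon> * (2 * (\<Lambda> + 2 * B + 1)) \<le> d"
      using \<open>\<epsilon> \<le> \<epsilon>1\<close> \<Lambda>0 B by (simp add: \<epsilon>1_def pos_le_divide_eq)
    moreover have "0 \<le> \<Lambda> * \<epsilon>" "0 \<le> B * \<epsilon>" using \<epsilon> \<Lambda>0 B by auto
    ultimately have small: "\<Lambda> * \<epsilon> < d" "2 * (B * \<epsilon>) < d"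
      using \<epsilon> d by (auto simp: algebra_simps)
    define P where "P i j = (\<epsilon> * real i, \<epsilon> * real j)" for i j :: nat
    define E where "E i j = norm (a\<epsilon> \<epsilon> (P i j) - a (P i j))" for i j
    define F where "F i j = norm (b\<epsilon> \<epsilon> (P i j) - b (P i j))" for i j
    define v where "v i j = (a\<epsilon> \<epsilon> (P i j), b\<epsilon> \<epsilon> (P i j))" for i j
    have P_in: "P i j \<in> Square \<rho>" if "\<epsilon> * real i \<le> \<rho>" "\<epsilon> * real j \<le> \<rho>" for i j
      using that \<epsilon> by (simp add: P_def Square_def)
    have v: "norm (v i j - u (P i j)) \<le> E i j + F i j" for i j
      using norm_Pair_le by (simp add: v_def u_def E_def F_def)
    have bnd: "C * norm (v i j - u (P i j)) + (C + C * \<Lambda>) * \<epsilon> \<le> C * (E i j + F i j) + A * \<epsilon>" for i j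
      using C A \<epsilon> v by (intro add_mono mult_left_mono mult_right_mono) auto
    have bound: "E i j \<le> A * \<epsilon> * exp ((2 * C + 1) * (\<epsilon> * real (i + j))) \<and>
         F i j \<le> A * \<epsilon> * exp ((2 * C + 1) * (\<epsilon> * real (i + j)))"
      if "\<epsilon> * real i \<le> \<rho>" "\<epsilon> * real j \<le> \<rho>" for i j
    proof (rule discrete_Gronwall[OF \<epsilon> C A(4) _ _ _ _ _ that, where d = d])
      fix i assume i: "\<epsilon> * real i \<le> \<rho>"
      then have x: "\<epsilon> * real i \<in> grid \<epsilon> r" using \<rho> \<epsilon> by (intro gridI) auto
      have "a\<epsilon> \<epsilon> (P i 0) = a0\<epsilon> \<epsilon> (\<epsilon> * real i)" "a (P i 0) = a0 (\<epsilon> * real i)"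
        "b\<epsilon> \<epsilon> (P 0 i) = b0\<epsilon> \<epsilon> (\<epsilon> * real i)" "b (P 0 i) = b0 (\<epsilon> * real i)"
        using disc[OF m] sol x i \<epsilon> by (auto simp: P_def solves_discrete_Goursat_def solves_Goursat_def)
      then have "E i 0 \<le> Ca * \<epsilon>" "F 0 i \<le> Cb * \<epsilon>"
        using Ca[OF m x] Cb[OF m x] by (auto simp: E_def F_def)
      then show "E i 0 \<le> A * \<epsilon>" "F 0 i \<le> A * \<epsilon>"
        using A \<epsilon> by (auto intro: order_trans[OF _ mult_right_mono])
    next
      fix i j
      assume i: "\<epsilon> * real i \<le> \<rho>" and j: "\<epsilon> * real (Suc j) \<le> \<rho>" and near: "E i j + F i j < d"
      let ?x = "\<epsilon> * real i" and ?y = "\<epsilon> * real j"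
      have y: "?y + \<epsilon> = \<epsilon> * real (Suc j)" by (simp add: algebra_simps)
      have in_S: "(?x, t) \<in> Square \<rho>" if "t \<in> {?y..?y + \<epsilon>}" for t
      proof -
        have "?y \<le> t" "t \<le> \<rho>" using that j unfolding y by auto
        moreover have "0 \<le> ?x" "0 \<le> ?y" using \<epsilon> by auto
        ultimately show ?thesis using i order_trans[of 0 ?y t] by (simp add: Square_def)
      qed
      have sub: "{?y..?y + \<epsilon>} \<subseteq> {0..\<rho>}"
      proof
        fix t assume "t \<in> {?y..?y + \<epsilon>}"
        from in_S[OF this] show "t \<in> {0..\<rho>}" by (simp add: Square_def)
      qed
      have "norm (a\<epsilon> \<epsilon> (P i j) + \<epsilon> *\<^sub>R f\<epsilon> \<epsilon> (v i j) - a (?x, ?y + \<epsilon>)) \<le>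
        norm (a\<epsilon> \<epsilon> (P i j) - a (?x, ?y)) + \<epsilon> * (C * norm (v i j - u (?x, ?y)) + (C + C * \<Lambda>) * \<epsilon>)"
      proof (rule one_step_error[where u = "\<lambda>t. u (?x, t)" and h = f and d = d, OF \<epsilon> C])
        fix t assume t: "t \<in> {?y..?y + \<epsilon>}"
        have "((\<lambda>t. a (?x, t)) has_vector_derivative f (u (?x, t))) (at t within {0..\<rho>})"
          using sol in_S[OF t] by (auto simp: solves_Goursat_def u_def)
        then show "((\<lambda>t. a (?x, t)) has_vector_derivative f (u (?x, t))) (at t within {?y..?y + \<epsilon>})"
          by (rule has_vector_derivative_within_subset[OF _ sub])
        have "norm (u (?x, t) - u (?x, ?y)) \<le> \<Lambda> * dist (?x, t) (?x, ?y)"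
          using u_lip in_S[OF t] in_S[of ?y] \<epsilon> by auto
        also have "\<dots> \<le> \<Lambda> * \<epsilon>"
          using \<Lambda>0 t by (intro mult_left_mono) (auto simp: dist_Pair_Pair dist_real_def)
        finally show "norm (u (?x, t) - u (?x, ?y)) \<le> \<Lambda> * \<epsilon>" .
      next
        fix q assume "norm (q - u (?x, ?y)) < d"
        with in_S[of ?y] \<epsilon> m show "norm (f q - f (u (?x, ?y))) \<le> C * norm (q - u (?x, ?y))"
            "norm (f\<epsilon> \<epsilon> q - f q) \<le> C * \<epsilon>"
          by (auto intro: nearf nearf\<epsilon>)
      next
        show "norm (v i j - u (?x, ?y)) < d" using v[of i j] near by (simp add: P_def)
      qed (fact small)
      also have "\<dots> \<le> E i j + \<epsilon> * (C * (E i j + F i j) + A * \<epsilon>)"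
        using bnd[of i j] \<epsilon> by (simp add: E_def P_def)
      finally show "E i (Suc j) \<le> E i j + \<epsilon> * (C * (E i j + F i j) + A * \<epsilon>)"
        using discrete_step_y[OF disc[OF m] \<epsilon>, of i j] i j \<rho> unfolding y by (simp add: E_def P_def v_def)
    next
      \<comment> \<open>The mirror image: the step goes in \<open>x\<close> and advances
        \<open>b\<close>, and \<open>u\<close> is compared along a horizontal segment.\<close>
      fix i j
      assume i: "\<epsilon> * real (Suc i) \<le> \<rho>" and j: "\<epsilon> * real j \<le> \<rho>" and near: "E i j + F i j < d"
      let ?x = "\<epsilon> * real i" and ?y = "\<epsilon> * real j"
      have x: "?x + \<epsilon> = \<epsilon> * real (Suc i)" by (simp add: algebra_simps)
      have in_S: "(s, ?y) \<in> Square \<rho>" if "s \<in> {?x..?x + \<epsilon>}" for s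
      proof -
        have "?x \<le> s" "s \<le> \<rho>" using that i unfolding x by auto
        moreover have "0 \<le> ?x" "0 \<le> ?y" using \<epsilon> by auto
        ultimately show ?thesis using j order_trans[of 0 ?x s] by (simp add: Square_def)
      qed
      have sub: "{?x..?x + \<epsilon>} \<subseteq> {0..\<rho>}"
      proof
        fix s assume "s \<in> {?x..?x + \<epsilon>}"
        from in_S[OF this] show "s \<in> {0..\<rho>}" by (simp add: Square_def)
      qed
      have "norm (b\<epsilon> \<epsilon> (P i j) + \<epsilon> *\<^sub>R g\<epsilon> \<epsilon> (v i j) - b (?x + \<epsilon>, ?y)) \<le>
        norm (b\<epsilon> \<epsilon> (P i j) - b (?x, ?y)) + \<epsilon> * (C * norm (v i j - u (?x, ?y)) + (C + C * \<Lambda>) * \<epsilon>)"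
      proof (rule one_step_error[where u = "\<lambda>s. u (s, ?y)" and h = g and d = d and w = "\<lambda>s. b (s, ?y)", OF \<epsilon> C])
        fix s assume s: "s \<in> {?x..?x + \<epsilon>}"
        have "((\<lambda>s. b (s, ?y)) has_vector_derivative g (u (s, ?y))) (at s within {0..\<rho>})"
          using sol in_S[OF s] by (auto simp: solves_Goursat_def u_def)
        then show "((\<lambda>s. b (s, ?y)) has_vector_derivative g (u (s, ?y))) (at s within {?x..?x + \<epsilon>})"
          by (rule has_vector_derivative_within_subset[OF _ sub])
        have "norm (u (s, ?y) - u (?x, ?y)) \<le> \<Lambda> * dist (s, ?y) (?x, ?y)"
          using u_lip in_S[OF s] in_S[of ?x] \<epsilon> by auto
        also have "\<dots> \<le> \<Lambda> * \<epsilon>"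
          using \<Lambda>0 s by (intro mult_left_mono) (auto simp: dist_Pair_Pair dist_real_def)
        finally show "norm (u (s, ?y) - u (?x, ?y)) \<le> \<Lambda> * \<epsilon>" .
      next
        fix q assume "norm (q - u (?x, ?y)) < d"
        with in_S[of ?x] \<epsilon> m show "norm (g q - g (u (?x, ?y))) \<le> C * norm (q - u (?x, ?y))"
            "norm (g\<epsilon> \<epsilon> q - g q) \<le> C * \<epsilon>"
          by (auto intro: nearg nearg\<epsilon>)
      next
        show "norm (v i j - u (?x, ?y)) < d" using v[of i j] near by (simp add: P_def)
      qed (fact small)
      also have "\<dots> \<le> F i j + \<epsilon> * (C * (E i j + F i j) + A * \<epsilon>)"
        using bnd[of i j] \<epsilon> by (simp add: F_def P_def)
      finally show "F (Suc i) j \<le> F i j + \<epsilon> * (C * (E i j + F i j) + A * \<epsilon>)"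
        using discrete_step_x[OF disc[OF m] \<epsilon>, of i j] i j \<rho> unfolding x by (simp add: F_def P_def v_def)
    next
      show "2 * (A * \<epsilon> * exp ((2 * C + 1) * (2 * \<rho>))) < d" using small by (simp add: B_def mult_ac)
    qed
    obtain i j where ij: "\<epsilon> * real i \<le> \<rho>" "\<epsilon> * real j \<le> \<rho>" and p_eq: "p = P i j"
      using p gridE[OF _ \<epsilon>] unfolding Grid2_def P_def by (metis mem_Times_iff prod.collapse)
    have "(2 * C + 1) * (\<epsilon> * real (i + j)) \<le> (2 * C + 1) * (2 * \<rho>)"
      using ij C by (intro mult_left_mono) (auto simp: distrib_left)
    then have "A * \<epsilon> * exp ((2 * C + 1) * (\<epsilon> * real (i + j))) \<le> A * \<epsilon> * exp ((2 * C + 1) * (2 * \<rho>))"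
      using A \<epsilon> by (intro mult_left_mono) auto
    also have "\<dots> = B * \<epsilon>" by (simp add: B_def)
    finally show ?thesis using bound[OF ij] unfolding E_def F_def p_eq by linarith
  qed
  have fin: "finite (Grid2 \<epsilon> \<rho>)" if "\<epsilon> \<in> mesh_sizes \<epsilon>0" for \<epsilon>
    using finite_grid[OF mesh_sizes_pos[OF that]] by (simp add: Grid2_def)
  have "eq_up_to_O_eps \<epsilon>0 (\<lambda>\<epsilon>. Grid2 \<epsilon> \<rho>) a\<epsilon> a" "eq_up_to_O_eps \<epsilon>0 (\<lambda>\<epsilon>. Grid2 \<epsilon> \<rho>) b\<epsilon> b"
    using main by (auto intro!: eq_up_to_O_eps_of_small[OF \<epsilon>1 fin])
  with lip sol show ?thesis unfolding converges_to_Goursat_solution_def by blast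
qed

section \<open>Local existence and the theorem\<close>

text \<open>In a general normed space the radial retraction onto a ball need not be nonexpansive;
  the triangle inequality gives the constant 2. Writing the scaling factor with \<open>max\<close>
  covers points inside and outside the ball at once.\<close>

lemma lipschitz_radial_extension:
  fixes h :: "'v::real_normed_vector \<Rightarrow> 'w::metric_space"
  assumes h: "L-lipschitz_on (cball p d) h" and d: "0 < d"
  obtains h' where "(L * 2)-lipschitz_on UNIV h'" "\<And>q. q \<in> cball p d \<Longrightarrow> h' q = h q"
proof -
  define s :: "'v \<Rightarrow> real" where "s z = d / max d (norm z)" for z
  define R where "R q = p + s (q - p) *\<^sub>R (q - p)" for q
  have s: "0 < s z" "s z \<le> 1" "s z * norm z \<le> d" for z
    using d by (auto simp: s_def max_def divide_le_eq intro!: divide_pos_pos)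
  have R_in: "R q \<in> cball p d" for q
    using s[of "q - p"] by (simp add: R_def dist_norm)
  \<comment> \<open>In the difference of the two factors the denominator
    \<open>max d (norm w)\<close> survives, and it compensates \<open>norm w\<close>; the numerators
    differ by at most \<open>norm (z - w)\<close>.\<close>
  have ds: "\<bar>s z - s w\<bar> * norm w \<le> norm (z - w)" for z w
  proof -
    let ?m = "\<lambda>z. max d (norm z)"
    have m: "0 < ?m z" for z using d by auto
    have "s z - s w = s z * ((?m w - ?m z) / ?m w)"
      using m[of z] m[of w] by (simp add: s_def field_simps)
    then have "\<bar>s z - s w\<bar> * norm w = s z * \<bar>?m w - ?m z\<bar> * (norm w / ?m w)"
      using s[of z] m[of w] by (simp add: abs_mult abs_divide)
    also have "\<dots> \<le> 1 * norm (z - w) * 1"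
      using s[of z] m[of w] norm_triangle_ineq3[of z w] by (intro mult_mono) (auto simp: max_def)
    finally show ?thesis by simp
  qed
  have R: "2-lipschitz_on UNIV R"
  proof (rule lipschitz_onI)
    fix x y
    define z w where "z = x - p" and "w = y - p"
    have "dist (R x) (R y) = norm (s z *\<^sub>R (z - w) + (s z - s w) *\<^sub>R w)"
      by (simp add: R_def dist_norm z_def w_def algebra_simps)
    also have "\<dots> \<le> s z * norm (z - w) + \<bar>s z - s w\<bar> * norm w"
      using s[of z] by (intro norm_triangle_le) auto
    also have "\<dots> \<le> 1 * norm (z - w) + norm (z - w)"
      using s[of z] by (intro add_mono mult_right_mono ds) auto
    finally show "dist (R x) (R y) \<le> 2 * dist x y" by (simp add: z_def w_def dist_norm)
  qed auto
  have "(L * 2)-lipschitz_on UNIV (h \<circ> R)"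
    by (rule lipschitz_on_compose[OF R]) (use R_in in \<open>auto intro: lipschitz_on_subset[OF h]\<close>)
  moreover have "(h \<circ> R) q = h q" if "q \<in> cball p d" for q
  proof -
    have "max d (norm (q - p)) = d" using that by (auto simp: dist_norm norm_minus_commute)
    then show ?thesis using d by (simp add: R_def s_def)
  qed
  ultimately show ?thesis by (rule that)
qed

text \<open>This removes the cut-off: agreement of the right-hand sides along the values of the
  solution is enough.\<close>

lemma solves_Goursat_subsquare:
  assumes sol: "solves_Goursat r f' g' a0 b0 a b" and \<rho>: "\<rho> \<le> r"
    and f: "\<And>p. p \<in> Square \<rho> \<Longrightarrow> f' (a p, b p) = f (a p, b p)"
    and g: "\<And>p. p \<in> Square \<rho> \<Longrightarrow> g' (a p, b p) = g (a p, b p)"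
  shows "solves_Goursat \<rho> f g a0 b0 a b"
proof -
  have sub: "{0..\<rho>} \<subseteq> {0..r}" using \<rho> by auto
  have "((\<lambda>t. a (x, t)) has_vector_derivative f (a (x, y), b (x, y))) (at y within {0..\<rho>})"
    "((\<lambda>s. b (s, y)) has_vector_derivative g (a (x, y), b (x, y))) (at x within {0..\<rho>})"
    if "(x, y) \<in> Square \<rho>" for x y
  proof -
    have "(x, y) \<in> Square r" using that sub by (auto simp: Square_def)
    with sol have "((\<lambda>t. a (x, t)) has_vector_derivative f' (a (x, y), b (x, y))) (at y within {0..r})"
      "((\<lambda>s. b (s, y)) has_vector_derivative g' (a (x, y), b (x, y))) (at x within {0..r})"
      by (auto simp: solves_Goursat_def)
    then show "((\<lambda>t. a (x, t)) has_vector_derivative f (a (x, y), b (x, y))) (at y within {0..\<rho>})"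
      "((\<lambda>s. b (s, y)) has_vector_derivative g (a (x, y), b (x, y))) (at x within {0..\<rho>})"
      using f[OF that] g[OF that] has_vector_derivative_within_subset[OF _ sub] by auto
  qed
  with sol sub show ?thesis unfolding solves_Goursat_def by auto
qed

lemma local_Goursat_solution:
  fixes f g :: "'v::banach \<times> 'v \<Rightarrow> 'v"
  assumes f: "C1_on UNIV f" and g: "C1_on UNIV g" and r: "0 < r"
    and a0: "L0-lipschitz_on {0..r} a0" and b0: "L0-lipschitz_on {0..r} b0"
  obtains \<rho> a b where "\<rho> \<in> {0<..r}" "is_Lipschitz_on (Square \<rho>) a" "is_Lipschitz_on (Square \<rho>) b"
    "solves_Goursat \<rho> f g a0 b0 a b"
proof -
  let ?p = "(a0 0, b0 0)"
  obtain d1 L1 where 1: "0 < d1" "L1-lipschitz_on (ball ?p d1) f"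
    using C1_on_imp_local_lipschitz_on[OF f] by blast
  obtain d2 L2 where 2: "0 < d2" "L2-lipschitz_on (ball ?p d2) g"
    using C1_on_imp_local_lipschitz_on[OF g] by blast
  \<comment> \<open>Halved so that the closed ball lies in both open balls.\<close>
  define d where "d = min d1 d2 / 2"
  have d: "0 < d" using 1 2 by (simp add: d_def)
  have "cball ?p d \<subseteq> ball ?p d1" "cball ?p d \<subseteq> ball ?p d2" using 1 2 by (auto simp: d_def)
  then have "L1-lipschitz_on (cball ?p d) f" "L2-lipschitz_on (cball ?p d) g"
    using 1 2 by (auto intro: lipschitz_on_subset)
  then obtain f' g' where f': "(L1 * 2)-lipschitz_on UNIV f'" "\<And>q. q \<in> cball ?p d \<Longrightarrow> f' q = f q"
    and g': "(L2 * 2)-lipschitz_on UNIV g'" "\<And>q. q \<in> cball ?p d \<Longrightarrow> g' q = g q"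
    using lipschitz_radial_extension[OF _ d] by metis
  \<comment> \<open>The 1 ensures \<open>0 < L\<close>, since the given Lipschitz constants may
    vanish.\<close>
  define L where "L = max 1 (max (L1 * 2) (L2 * 2))"
  have "L-lipschitz_on UNIV f'" "L-lipschitz_on UNIV g'" "0 < L"
    using f'(1) g'(1) by (auto simp: L_def intro: lipschitz_on_le)
  \<comment> \<open>The modified problem is solved on the whole square. The square is shrunk only
    afterwards, by continuity of this solution at the corner.\<close>
  from global_Goursat_solution[OF this a0 b0]
  obtain a b where ab: "is_Lipschitz_on (Square r) a" "is_Lipschitz_on (Square r) b"
    and sol: "solves_Goursat r f' g' a0 b0 a b" by blast
  have "continuous_on (Square r) (\<lambda>p. (a p, b p))"
    using ab by (auto simp: is_Lipschitz_on_def dest!: lipschitz_on_continuous_on intro!: continuous_intros)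
  moreover have "(0, 0) \<in> Square r" using r by (simp add: Square_def)
  ultimately obtain e where e: "0 < e"
    "\<And>p. p \<in> Square r \<Longrightarrow> dist p (0, 0) < e \<Longrightarrow> dist (a p, b p) (a (0, 0), b (0, 0)) < d"
    using d unfolding continuous_on_iff by meson
  \<comment> \<open>The distance to the corner is at most \<open>x + y\<close>, hence at most two
    thirds of \<open>e\<close>.\<close>
  define \<rho> where "\<rho> = min r (e / 3)"
  have \<rho>: "0 < \<rho>" "\<rho> \<le> r" "\<rho> \<le> e / 3" using e r by (auto simp: \<rho>_def)
  have sub: "Square \<rho> \<subseteq> Square r" using \<rho> by (auto simp: Square_def)
  have ab0: "(a (0, 0), b (0, 0)) = ?p" using sol r by (auto simp: solves_Goursat_def)
  have near: "(a p, b p) \<in> cball ?p d" if "p \<in> Square \<rho>" for p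
  proof -
    obtain x y where [simp]: "p = (x, y)" by (cases p)
    have "dist p (0, 0) \<le> norm x + norm y"
      using norm_Pair_le[of x y] by (simp add: dist_norm)
    also have "\<dots> < e" using that \<rho> e(1) by (auto simp: Square_def)
    finally have "dist (a p, b p) ?p < d" using e(2)[of p] that sub ab0 by auto
    then show ?thesis by (simp add: dist_commute)
  qed
  show ?thesis
  proof (rule that)
    show "\<rho> \<in> {0<..r}" using \<rho> by auto
    show "is_Lipschitz_on (Square \<rho>) a" "is_Lipschitz_on (Square \<rho>) b"
      using ab sub by (auto simp: is_Lipschitz_on_def intro: lipschitz_on_subset)
    show "solves_Goursat \<rho> f g a0 b0 a b"
      using near \<rho> by (intro solves_Goursat_subsquare[OF sol] f'(2) g'(2)) auto
  qed
qed

theorem theorem1: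
  fixes f g :: "'v::banach \<times> 'v \<Rightarrow> 'v"
    and f\<epsilon> g\<epsilon> :: "real \<Rightarrow> 'v \<times> 'v \<Rightarrow> 'v"
    and a0 b0 :: "real \<Rightarrow> 'v"
    and a0\<epsilon> b0\<epsilon> :: "real \<Rightarrow> real \<Rightarrow> 'v"
    and a\<epsilon> b\<epsilon> :: "real \<Rightarrow> real \<times> real \<Rightarrow> 'v"
    and r \<epsilon>0 :: real
  assumes "0 < r" and "0 < \<epsilon>0"
    and "C1_on UNIV f" and "C1_on UNIV g"
    and "C1_on {0..r} a0" and "C1_on {0..r} b0"
    and "\<And>\<epsilon>. \<epsilon> \<in> mesh_sizes \<epsilon>0 \<Longrightarrow> C1_on UNIV (f\<epsilon> \<epsilon>)"
    and "\<And>\<epsilon>. \<epsilon> \<in> mesh_sizes \<epsilon>0 \<Longrightarrow> C1_on UNIV (g\<epsilon> \<epsilon>)"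
    and "C1_approximation \<epsilon>0 f\<epsilon> f" and "C1_approximation \<epsilon>0 g\<epsilon> g"
    and "eq_up_to_O_eps \<epsilon>0 (\<lambda>\<epsilon>. grid \<epsilon> r) a0\<epsilon> a0"
    and "eq_up_to_O_eps \<epsilon>0 (\<lambda>\<epsilon>. grid \<epsilon> r) b0\<epsilon> b0"
    and "\<And>\<epsilon>. \<epsilon> \<in> mesh_sizes \<epsilon>0 \<Longrightarrow>
           solves_discrete_Goursat \<epsilon> r (f\<epsilon> \<epsilon>) (g\<epsilon> \<epsilon>) (a0\<epsilon> \<epsilon>) (b0\<epsilon> \<epsilon>) (a\<epsilon> \<epsilon>) (b\<epsilon> \<epsilon>)"
  shows "(\<exists>r'\<in>{0<..r}. converges_to_Goursat_solution \<epsilon>0 r' f g a0 b0 a\<epsilon> b\<epsilon>) \<and>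
    (is_Lipschitz_on UNIV f \<and> is_Lipschitz_on UNIV g \<longrightarrow>
       converges_to_Goursat_solution \<epsilon>0 r f g a0 b0 a\<epsilon> b\<epsilon>)"
proof -
  obtain La Lb where "La-lipschitz_on {0..r} a0" "Lb-lipschitz_on {0..r} b0"
    using C1_on_imp_lipschitz_on_interval assms(5,6) by metis
  then have ab0: "(max La Lb)-lipschitz_on {0..r} a0" "(max La Lb)-lipschitz_on {0..r} b0"
    by (auto intro: lipschitz_on_le)
  have conv: "converges_to_Goursat_solution \<epsilon>0 \<rho> f g a0 b0 a\<epsilon> b\<epsilon>"
    if "0 < \<rho>" "\<rho> \<le> r" "is_Lipschitz_on (Square \<rho>) a" "is_Lipschitz_on (Square \<rho>) b"
      "solves_Goursat \<rho> f g a0 b0 a b" for \<rho> a b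
    by (rule Goursat_convergence[OF assms(3,9,4,10-12) _ that]) (rule assms(13))
  have "\<exists>r'\<in>{0<..r}. converges_to_Goursat_solution \<epsilon>0 r' f g a0 b0 a\<epsilon> b\<epsilon>"
    using local_Goursat_solution[OF assms(3,4,1) ab0] conv by (metis greaterThanAtMost_iff)
  \<comment> \<open>With global Lipschitz constants no cut-off intervenes, so the solution on the
    whole square already solves the original problem.\<close>
  moreover have "converges_to_Goursat_solution \<epsilon>0 r f g a0 b0 a\<epsilon> b\<epsilon>"
    if "is_Lipschitz_on UNIV f" "is_Lipschitz_on UNIV g"
  proof -
    obtain Lf Lg where "Lf-lipschitz_on UNIV f" "Lg-lipschitz_on UNIV g"
      using \<open>is_Lipschitz_on UNIV f\<close> \<open>is_Lipschitz_on UNIV g\<close> by (auto simp: is_Lipschitz_on_def)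
    then have "(max 1 (max Lf Lg))-lipschitz_on UNIV f" "(max 1 (max Lf Lg))-lipschitz_on UNIV g"
      by (auto intro: lipschitz_on_le)
    from global_Goursat_solution[OF this _ ab0] conv[OF assms(1) order_refl]
    show ?thesis by (metis less_max_iff_disj zero_less_one)
  qed
  ultimately show ?thesis by blast
qed

end
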